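(* Let $d\ge 1$ be an integer and $\ell=(\ell_1,\dots,\ell_d)\in\mathbb{Z}_{\ge 0}^d$. Let $f:\mathbb{D}^d\to\mathbb{C}$ and $g=(g_1,\dots,g_d):\mathbb{D}^d\to\mathbb{D}^d$ be analytic functions. Then the operator $W_{f,g,\max}$ is unitary on $\mathcal{B}_\ell(\mathbb{D}^d)$ if and only if $$f(z)=\mathbf{c}\prod_{j=1}^d\frac{(1-|\theta_j|^2)^{1+\ell_j/2}}{(1-\mathbf{a}_j\overline{\theta_j}z_{\phi(j)})^{\ell_j+2}},\qquad g_\kappa(z)=\frac{\mathbf{a}_\kappa(\overline{\mathbf{a}_\kappa}\theta_\kappa-z_{\phi(\kappa)})}{1-\mathbf{a}_\kappa\overline{\theta_\kappa}z_{\phi(\kappa)}}\quad\text{for all }\kappa\in\{1,\dots,d\},\ z\in\mathbb{D}^d,$$ where $\phi:\{1,\dots,d\}\to\{1,\dots,d\}$ is bijective, $\mathbf{c}\in\mathbb{T}$, $\mathbf{a}_\kappa\in\mathbb{T}$ for every $\kappa\in\{1,\dots,d\}$, and $\theta=(\theta_1,\dots,\theta_d)\in\mathbb{D}^d$.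
   Context: $\mathbb{D}=\{z\in\mathbb{C}:|z|<1\}$, $\mathbb{T}=\{z\in\mathbb{C}:|z|=1\}$, and $\mathbb{D}^d$ is the polydisk in $\mathbb{C}^d$. The Bergman space $\mathcal{B}_\ell(\mathbb{D}^d)$ is the Hilbert space of all analytic functions $\xi:\mathbb{D}^d\to\mathbb{C}$ with $$\|\xi\|^2=\int_{\mathbb{D}^d}|\xi(z)|^2\prod_{j=1}^d(1+\ell_j)(1-|z_j|^2)^{\ell_j}\,dA(z_j)<\infty,$$ where $dA$ is the normalized area measure on $\mathbb{D}$. The maximal weighted composition operator $W_{f,g,\max}$ has domain $\{\xi\in\mathcal{B}_\ell(\mathbb{D}^d): f\cdot(\xi\circ g)\in\mathcal{B}_\ell(\mathbb{D}^d)\}$ and acts by $(W_{f,g,\max}\xi)(z)=f(z)\xi(g(z))$. It is not assumed to be bounded. A bounded (everywhere defined) linear operator $Q$ is called unitary if $QQ^*=Q^*Q=I$.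
   Formalization: The bijection φ is additionally required to satisfy ℓ_{φ(j)} = ℓ_j for all j; without this the "if" direction fails, e.g. d=2, ℓ=(0,1), φ the swap, θ=0, a=(−1,−1), c=1, where z₁ (squared norm 1/2) is sent to z₂ (squared norm 1/3). *)

theory Defs
  imports "HOL-Analysis.Analysis"
begin

text \<open>
  The space \<open>\<complex>\<^sup>d\<close> is \<open>complex ^ 'n\<close>, with the finite index type \<open>'n\<close> in the role of
  \<open>{1, \<dots>, d}\<close>.
\<close>

definition polydisk :: "(complex ^ 'n) set" where
  "polydisk = {z. \<forall>j. z $ j \<in> ball 0 1}"

text \<open>
  Analyticity in several variables is complex Frechet differentiability, as for
  \<^const>\<open>field_differentiable\<close> and \<open>holomorphic_on\<close> in one variable: the real derivative exists
  and is of the form \<open>v \<mapsto> \<Sum>\<^sub>j c\<^sub>j v\<^sub>j\<close> with complex \<open>c\<^sub>j\<close>.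
\<close>

definition mv_holomorphic_on :: "(complex ^ 'n \<Rightarrow> complex) \<Rightarrow> (complex ^ 'n) set \<Rightarrow> bool" where
  "mv_holomorphic_on h S \<longleftrightarrow>
     (\<forall>z\<in>S. \<exists>c :: complex ^ 'n. (h has_derivative (\<lambda>v. \<Sum>j\<in>UNIV. c $ j * v $ j)) (at z within S))"

definition disk_area :: "complex measure" where
  "disk_area = uniform_measure lborel (ball 0 1)"

definition polydisk_area :: "(complex ^ 'n) measure" where
  "polydisk_area = distr (\<Pi>\<^sub>M j\<in>UNIV. disk_area) borel (\<lambda>w. \<chi> j. w j)"

definition bergman_weight :: "nat ^ 'n \<Rightarrow> complex ^ 'n \<Rightarrow> real" where
  "bergman_weight l z = (\<Prod>j\<in>UNIV. (1 + real (l $ j)) * (1 - (cmod (z $ j))\<^sup>2) ^ (l $ j))"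

text \<open>
  A function on the polydisk is represented by its extension by \<open>0\<close> to \<open>complex ^ 'n\<close>, so that
  equality of elements of the space is equality of HOL functions.
\<close>

definition bergman :: "nat ^ 'n \<Rightarrow> (complex ^ 'n \<Rightarrow> complex) set" where
  "bergman l = {\<xi>. mv_holomorphic_on \<xi> polydisk \<and> (\<forall>z. z \<notin> polydisk \<longrightarrow> \<xi> z = 0) \<and>
     set_integrable polydisk_area polydisk (\<lambda>z. (cmod (\<xi> z))\<^sup>2 * bergman_weight l z)}"

definition bergman_inner ::
    "nat ^ 'n \<Rightarrow> (complex ^ 'n \<Rightarrow> complex) \<Rightarrow> (complex ^ 'n \<Rightarrow> complex) \<Rightarrow> complex" where
  "bergman_inner l \<xi> \<eta> =
     (LINT z:polydisk|polydisk_area. \<xi> z * cnj (\<eta> z) * complex_of_real (bergman_weight l z))"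

definition bergman_norm :: "nat ^ 'n \<Rightarrow> (complex ^ 'n \<Rightarrow> complex) \<Rightarrow> real" where
  "bergman_norm l \<xi> =
     sqrt (LINT z:polydisk|polydisk_area. (cmod (\<xi> z))\<^sup>2 * bergman_weight l z)"

text \<open>A possibly unbounded operator is a pair consisting of its domain and its action.\<close>

type_synonym 'n partial_op =
  "(complex ^ 'n \<Rightarrow> complex) set \<times> ((complex ^ 'n \<Rightarrow> complex) \<Rightarrow> complex ^ 'n \<Rightarrow> complex)"

definition bounded_op :: "nat ^ 'n \<Rightarrow> 'n partial_op \<Rightarrow> bool" where
  "bounded_op l Q \<longleftrightarrow> fst Q = bergman l \<and> snd Q ` bergman l \<subseteq> bergman l \<and>
     (\<forall>\<xi>\<in>bergman l. \<forall>\<eta>\<in>bergman l. \<forall>\<alpha> \<beta>.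
        snd Q (\<lambda>z. \<alpha> * \<xi> z + \<beta> * \<eta> z) = (\<lambda>z. \<alpha> * snd Q \<xi> z + \<beta> * snd Q \<eta> z)) \<and>
     (\<exists>C. \<forall>\<xi>\<in>bergman l. bergman_norm l (snd Q \<xi>) \<le> C * bergman_norm l \<xi>)"

definition is_adjoint :: "nat ^ 'n \<Rightarrow> 'n partial_op \<Rightarrow> 'n partial_op \<Rightarrow> bool" where
  "is_adjoint l Q R \<longleftrightarrow> bounded_op l R \<and>
     (\<forall>\<xi>\<in>bergman l. \<forall>\<eta>\<in>bergman l. bergman_inner l (snd Q \<xi>) \<eta> = bergman_inner l \<xi> (snd R \<eta>))"

text \<open>
  The adjoint \<open>R\<close> is determined on the whole space by \<^const>\<open>is_adjoint\<close>, so it is irrelevant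
  which \<open>R\<close> the existential quantifier picks.
\<close>

definition unitary_op :: "nat ^ 'n \<Rightarrow> 'n partial_op \<Rightarrow> bool" where
  "unitary_op l Q \<longleftrightarrow> bounded_op l Q \<and>
     (\<exists>R. is_adjoint l Q R \<and>
        (\<forall>\<xi>\<in>bergman l. snd Q (snd R \<xi>) = \<xi> \<and> snd R (snd Q \<xi>) = \<xi>))"

definition weighted_comp ::
    "(complex ^ 'n \<Rightarrow> complex) \<Rightarrow> (complex ^ 'n \<Rightarrow> complex ^ 'n) \<Rightarrow>
     (complex ^ 'n \<Rightarrow> complex) \<Rightarrow> complex ^ 'n \<Rightarrow> complex" where
  "weighted_comp f g \<xi> = (\<lambda>z. if z \<in> polydisk then f z * \<xi> (g z) else 0)"

definition weighted_comp_max ::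
    "nat ^ 'n \<Rightarrow> (complex ^ 'n \<Rightarrow> complex) \<Rightarrow> (complex ^ 'n \<Rightarrow> complex ^ 'n) \<Rightarrow> 'n partial_op" where
  "weighted_comp_max l f g = ({\<xi> \<in> bergman l. weighted_comp f g \<xi> \<in> bergman l}, weighted_comp f g)"

text \<open>
  Pitfall: the coordinate permutation \<open>\<phi>\<close> of a unitary weighted composition operator has to preserve
  the weight exponents, \<open>l $ \<phi> j = l $ j\<close>; bijectivity alone does not suffice.  On the bidisk with
  exponents \<open>(0, 1)\<close>, composition with the coordinate swap takes \<open>z\<^sub>1\<close>, of squared norm \<open>1/2\<close>, to
  \<open>z\<^sub>2\<close>, of squared norm \<open>1/3\<close>.  The condition is vacuous when all exponents are equal, in particular
  in one variable.
\<close>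

end

theory Submission
  imports Defs "HOL-Complex_Analysis.Cauchy_Integral_Formula"
begin

text \<open>
  Any \<open>(f, g)\<close> of the stated form gives a unitary operator: \<open>\<bar>f\<bar>\<^sup>2\<close> is the Jacobian of \<open>g\<close> with
  respect to the weighted measure, so \<open>W\<close> preserves inner products by a change of variables, and
  its inverse is an operator of the same form.

  Conversely, let \<open>K\<^sub>z(w) = \<Prod>\<^sub>j (1 - w\<^sub>j cnj z\<^sub>j) ^ -(l\<^sub>j + 2)\<close> be the reproducing kernel.  From
  \<open>W\<^sup>* K\<^sub>z = cnj (f z) K\<^bsub>g(z)\<^esub>\<close> and \<open>W W\<^sup>* = I\<close> one gets
  \<open>f(w) cnj (f z) K\<^bsub>g(z)\<^esub>(g w) = K\<^sub>z(w)\<close>.  Let \<open>h\<close> be \<open>g\<close> followed by the involution of the polydisk that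
  takes \<open>g(0)\<close> to \<open>0\<close>.  Then \<open>\<Prod>\<^sub>j (1 - h\<^sub>j(w) cnj (h\<^sub>j z)) ^ (l\<^sub>j + 2)\<close> is equal to
  \<open>\<Prod>\<^sub>j (1 - w\<^sub>j cnj z\<^sub>j) ^ (l\<^sub>j + 2)\<close>.  Differentiating in \<open>cnj z\<close> at \<open>0\<close> shows that an invertible matrix takes
  \<open>h(w)\<close> to \<open>w\<close>, so \<open>h\<close> is linear, and comparing both sides along the coordinate axes shows that
  the matrix of \<open>h\<close> is a permutation matrix with unimodular entries.
\<close>

section \<open>Change of variables under Moebius maps of the disk\<close>

text \<open>The change of variables serves both directions. Up to the total mass, evaluation at 0 is
  integration against the constant 1, by Cauchy's formula. The unitary operator of the involution
  that swaps 0 and \<open>w\<close> moves this to evaluation at \<open>w\<close> and so yields the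
  kernel there, without an orthonormal basis. In the converse, \<open>h\<close> vanishes at 0, so
  both products equal 1 at \<open>z = 0\<close>. This shows that the multiplier left over after the
  normalization is constant, and \<open>f\<close> drops out of the identity. Linearity comes from
  differentiating in one argument only, the other staying arbitrary. The shape of the matrix has two
  sources: along the i-th axis the right side tends to 0 at the boundary, which forces an entry of
  modulus 1 in column i; and a linear self-map of the polydisk has rows whose moduli sum to at most
  1, which leaves no room for further entries in the row found. The exponent
  \<open>1 + l_j / 2\<close> in \<open>f\<close> is half of \<open>l_j + 2\<close>, where 2 comes
  from the area and \<open>l_j\<close> from the weight.\<close>

text \<open>The library's change of variables theorem is available for \<open>real ^ 'n\<close> only, hence the detour through \<open>real ^ 2\<close>.\<close>

definition complex_of_vec :: "real ^ 2 \<Rightarrow> complex" where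
  "complex_of_vec x = Complex (x $ 1) (x $ 2)"

definition vec_of_complex :: "complex \<Rightarrow> real ^ 2" where
  "vec_of_complex z = (\<chi> i. if i = 1 then Re z else Im z)"

lemma vec_of_complex_nth [simp]: "vec_of_complex z $ 1 = Re z" "vec_of_complex z $ 2 = Im z"
  by (simp_all add: vec_of_complex_def)

lemma complex_of_vec_inverse [simp]: "vec_of_complex (complex_of_vec x) = x"
  by (simp add: vec_eq_iff forall_2 complex_of_vec_def)

lemma vec_of_complex_inverse [simp]: "complex_of_vec (vec_of_complex z) = z"
  by (simp add: complex_of_vec_def)

lemma bounded_linear_complex_of_vec: "bounded_linear complex_of_vec"
  by (intro linear_conv_bounded_linear[THEN iffD1] linearI)
     (auto simp: complex_of_vec_def complex_eq_iff)

lemma bounded_linear_vec_of_complex: "bounded_linear vec_of_complex"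
  by (intro linear_conv_bounded_linear[THEN iffD1] linearI)
     (auto simp: vec_eq_iff forall_2)

lemma borel_measurable_complex_of_vec [measurable]: "complex_of_vec \<in> borel_measurable borel"
  by (intro borel_measurable_continuous_onI linear_continuous_on bounded_linear_complex_of_vec)

text \<open>Lebesgue measure is determined by its values on boxes, and the preimage of a box is a
  box with the same side lengths.\<close>

lemma distr_complex_of_vec: "distr lborel borel complex_of_vec = lborel"
proof (rule lborel_eqI[symmetric])
  fix l u :: complex assume le: "\<And>b. b \<in> Basis \<Longrightarrow> l \<bullet> b \<le> u \<bullet> b"
  have *: "complex_of_vec -` box l u = box (vec_of_complex l) (vec_of_complex u)"
    by (auto simp: box_def Basis_complex_def Basis_vec_def complex_of_vec_def inner_axis forall_2)
  have "Re l \<le> Re u" "Im l \<le> Im u"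
    using le[of 1] le[of \<i>] by (auto simp: Basis_complex_def)
  then show "emeasure (distr lborel borel complex_of_vec) (box l u) = (\<Prod>b\<in>Basis. (u - l) \<bullet> b)"
    by (subst emeasure_distr)
       (auto simp: * emeasure_lborel_box_eq Basis_vec_def inner_axis UNIV_2 Basis_complex_def
          axis_eq_axis prod.insert_if)
qed simp

lemma nn_integral_complex_of_vec:
  assumes [measurable]: "f \<in> borel_measurable borel"
  shows "(\<integral>\<^sup>+z. f z \<partial>lborel) = (\<integral>\<^sup>+x. f (complex_of_vec x) \<partial>lborel)"
  by (subst distr_complex_of_vec[symmetric]) (simp add: nn_integral_distr)

text \<open>Multiplication by \<open>F' z\<close>, viewed as a real 2-by-2 matrix, has determinant
  \<open>(cmod (F' z))\<^sup>2\<close>, so this is the real change of variables formula.\<close>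

lemma emeasure_holomorphic_image:
  fixes F F' :: "complex \<Rightarrow> complex"
  assumes S [measurable]: "S \<in> sets borel" and FS [measurable]: "F ` S \<in> sets borel"
    and fin: "emeasure lborel (F ` S) < \<infinity>"
    and der: "\<And>z. z \<in> S \<Longrightarrow> (F has_field_derivative F' z) (at z within S)"
    and inj: "inj_on F S"
    and [measurable]: "F' \<in> borel_measurable borel"
  shows "emeasure lborel (F ` S) = (\<integral>\<^sup>+z. ennreal ((cmod (F' z))\<^sup>2) * indicator S z \<partial>lborel)"
proof -
  define S' where "S' = complex_of_vec -` S"
  define G where "G = (\<lambda>x. vec_of_complex (F (complex_of_vec x)))"
  define G' where "G' = (\<lambda>x v. vec_of_complex (F' (complex_of_vec x) * complex_of_vec v))"
  have S'm: "S' \<in> sets borel"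
    unfolding S'_def using measurable_sets[OF borel_measurable_complex_of_vec S] by simp
  have SI: "S' = vec_of_complex ` S"
    unfolding S'_def by (force simp: image_iff)
  have GS: "G ` S' = complex_of_vec -` (F ` S)"
    unfolding SI G_def by (auto simp: image_iff) (metis complex_of_vec_inverse)
  have GSm: "G ` S' \<in> sets borel"
    unfolding GS using measurable_sets[OF borel_measurable_complex_of_vec FS] by simp
  have eG: "emeasure lborel (G ` S') = emeasure lborel (F ` S)"
    using emeasure_distr[of complex_of_vec lborel borel "F ` S"] by (simp add: GS distr_complex_of_vec)
  have dG: "(G has_derivative G' x) (at x within S')" if "x \<in> S'" for x
  proof -
    have 1: "(complex_of_vec has_derivative complex_of_vec) (at x within S')"
      by (rule bounded_linear_imp_has_derivative[OF bounded_linear_complex_of_vec])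
    have 2: "(F has_derivative (*) (F' (complex_of_vec x))) (at (complex_of_vec x) within complex_of_vec ` S')"
      using der[of "complex_of_vec x"] that
      by (auto simp: S'_def has_field_derivative_def intro: has_derivative_subset)
    from has_derivative_in_compose[OF 1 2]
    have "((\<lambda>x. F (complex_of_vec x)) has_derivative (\<lambda>v. F' (complex_of_vec x) * complex_of_vec v)) (at x within S')"
      by simp
    from bounded_linear.has_derivative[OF bounded_linear_vec_of_complex this]
    show ?thesis by (simp add: G_def G'_def)
  qed
  have "inj_on G S'"
    using inj unfolding G_def inj_on_def S'_def
    by (metis complex_of_vec_inverse vec_of_complex_inverse vimage_eq)
  then have "((\<lambda>x. \<bar>det (matrix (G' x))\<bar>) has_integral measure lebesgue (G ` S')) S'"
    using has_measure_differentiable_image[of S' G G' "measure lebesgue (G ` S')"] dG S'm GSm fin eG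
    by (auto simp: fmeasurable_def)
  then have "(\<integral>\<^sup>+x. ennreal \<bar>det (matrix (G' x))\<bar> * indicator S' x \<partial>lborel) = ennreal (measure lebesgue (G ` S'))"
    by (intro nn_integral_has_integral_lebesgue') auto
  moreover have "\<bar>det (matrix (G' x))\<bar> = (cmod (F' (complex_of_vec x)))\<^sup>2" for x
    by (simp add: det_2 matrix_def G'_def axis_def complex_of_vec_def cmod_def power2_eq_square)
  moreover have "ennreal (measure lebesgue (G ` S')) = emeasure lborel (F ` S)"
    using fin eG GSm by (simp add: measure_def)
  ultimately show ?thesis
    by (subst nn_integral_complex_of_vec) (auto simp: S'_def indicator_def of_bool_def)
qed

text \<open>For \<open>cmod a = 1\<close> and \<open>cmod t < 1\<close> this is the rotation by
  \<open>a\<close> followed by the involution of the disk that swaps 0 and \<open>t\<close>. The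
  numerator agrees with that of the theorem, since
  \<open>a * (cnj a * t - z) = t - a * z\<close>.\<close>

definition disk_mobius :: "complex \<Rightarrow> complex \<Rightarrow> complex \<Rightarrow> complex" where
  "disk_mobius a t z = (t - a * z) / (1 - a * cnj t * z)"

text \<open>The modulus of the derivative of \<open>disk_mobius a t\<close>, and also the factor by
  which \<open>1 - (cmod z)\<^sup>2\<close> changes. Hence area scales by its square and the weight
  of exponent \<open>n\<close> by its \<open>n\<close>-th power.\<close>

definition mobius_jacobian :: "complex \<Rightarrow> complex \<Rightarrow> complex \<Rightarrow> real" where
  "mobius_jacobian a t z = (1 - (cmod t)\<^sup>2) / (cmod (1 - a * cnj t * z))\<^sup>2"

context
  fixes a t :: complex
  assumes a: "cmod a = 1" and t: "cmod t < 1"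
begin

lemma mobius_denom_nonzero:
  assumes "cmod z < 1"
  shows "1 - a * cnj t * z \<noteq> 0"
proof
  assume "1 - a * cnj t * z = 0"
  then have "1 = cmod (a * cnj t * z)" by simp
  also have "\<dots> = cmod t * cmod z" using a by (simp add: norm_mult)
  also have "\<dots> < 1" using t assms
    by (metis mult.right_neutral mult_strict_mono' norm_ge_zero)
  finally show False by simp
qed

lemma unimodular_mult_cnj: "a * cnj a = 1" "cnj a * a = 1"
  using a by (simp_all add: complex_norm_square[symmetric] mult.commute[of "cnj a"])

lemma one_minus_cnj_mult_nonzero: "1 - cnj t * t \<noteq> 0"
proof -
  have "1 - cnj t * t = of_real (1 - (cmod t)\<^sup>2)"
    by (simp add: complex_norm_square mult.commute del: of_real_power)
  moreover have "(cmod t)\<^sup>2 < 1" using t by (simp add: power_less_one_iff abs_square_less_1)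
  ultimately show ?thesis by (simp del: of_real_diff of_real_power)
qed

text \<open>The polarized Schwarz-Pick identity. Its diagonal case transforms the weight; its
  off-diagonal case carries the kernel identity over from \<open>g\<close> to
  \<open>h\<close>.\<close>

lemma one_minus_disk_mobius:
  assumes z: "cmod z < 1" and w: "cmod w < 1"
  shows "1 - disk_mobius a t z * cnj (disk_mobius a t w) =
    of_real (1 - (cmod t)\<^sup>2) * (1 - z * cnj w) / ((1 - a * cnj t * z) * cnj (1 - a * cnj t * w))"
proof -
  have "1 - a * cnj t * z \<noteq> 0" "cnj (1 - a * cnj t * w) \<noteq> 0"
    using mobius_denom_nonzero z w by (simp_all only: complex_cnj_zero_iff) auto
  then have "1 - disk_mobius a t z * cnj (disk_mobius a t w) =
    ((1 - a * cnj t * z) * cnj (1 - a * cnj t * w) - (t - a * z) * cnj (t - a * w))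
     / ((1 - a * cnj t * z) * cnj (1 - a * cnj t * w))"
    by (simp only: disk_mobius_def complex_cnj_divide) (simp add: divide_simps del: complex_cnj_diff)
  also have "(1 - a * cnj t * z) * cnj (1 - a * cnj t * w) - (t - a * z) * cnj (t - a * w) =
     (1 - t * cnj t) * (1 - (a * cnj a) * (z * cnj w))"
    by (simp add: algebra_simps)
  finally show ?thesis
    by (simp add: unimodular_mult_cnj complex_norm_square del: of_real_power)
qed

lemma one_minus_norm_disk_mobius:
  assumes "cmod z < 1"
  shows "1 - (cmod (disk_mobius a t z))\<^sup>2 = mobius_jacobian a t z * (1 - (cmod z)\<^sup>2)"
proof -
  have "of_real (1 - (cmod (disk_mobius a t z))\<^sup>2) = (of_real (mobius_jacobian a t z * (1 - (cmod z)\<^sup>2)) :: complex)"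
    using one_minus_disk_mobius[OF assms assms]
    by (simp only: of_real_diff of_real_mult mobius_jacobian_def of_real_divide complex_norm_square of_real_1) simp
  then show ?thesis by (simp only: of_real_eq_iff)
qed

lemma mobius_jacobian_pos:
  assumes "cmod z < 1"
  shows "mobius_jacobian a t z > 0"
  using mobius_denom_nonzero[OF assms] t
  by (simp add: mobius_jacobian_def power_less_one_iff abs_square_less_1)

lemma norm_disk_mobius_less_1:
  assumes "cmod z < 1"
  shows "cmod (disk_mobius a t z) < 1"
proof -
  have "mobius_jacobian a t z * (1 - (cmod z)\<^sup>2) > 0"
    using mobius_jacobian_pos[OF assms] assms by (simp add: abs_square_less_1)
  then show ?thesis
    by (simp add: one_minus_norm_disk_mobius[OF assms, symmetric] abs_square_less_1)
qed

lemma mobius_denom_disk_mobius: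
  assumes "cmod z < 1"
  shows "1 - cnj t * disk_mobius a t z = of_real (1 - (cmod t)\<^sup>2) / (1 - a * cnj t * z)"
  using mobius_denom_nonzero[OF assms]
  by (simp add: disk_mobius_def complex_norm_square divide_simps del: of_real_power) (simp add: algebra_simps)

text \<open>The involution is undone by itself, and then the rotation by \<open>cnj a\<close>;
  applying that rotation last instead of first turns the parameter \<open>t\<close> into
  \<open>cnj a * t\<close>.\<close>

lemma disk_mobius_inverse:
  assumes "cmod z < 1"
  shows "disk_mobius (cnj a) (cnj a * t) (disk_mobius a t z) = z"
proof -
  have d: "1 - a * cnj t * z \<noteq> 0" by (rule mobius_denom_nonzero[OF assms])
  have "1 - cnj a * cnj (cnj a * t) * disk_mobius a t z = 1 - (cnj a * a) * cnj t * disk_mobius a t z"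
    by simp
  also have "\<dots> = of_real (1 - (cmod t)\<^sup>2) / (1 - a * cnj t * z)"
    using mobius_denom_disk_mobius[OF assms] by (simp add: unimodular_mult_cnj)
  also have "\<dots> = (1 - cnj t * t) / (1 - a * cnj t * z)"
    by (simp add: complex_norm_square mult.commute del: of_real_power)
  finally have 1: "1 - cnj a * cnj (cnj a * t) * disk_mobius a t z = (1 - cnj t * t) / (1 - a * cnj t * z)" .
  have "cnj a * t - cnj a * disk_mobius a t z = cnj a * a * z * (1 - cnj t * t) / (1 - a * cnj t * z)"
    using d by (simp add: disk_mobius_def divide_simps) (simp add: algebra_simps)
  then have 2: "cnj a * t - cnj a * disk_mobius a t z = z * ((1 - cnj t * t) / (1 - a * cnj t * z))"
    by (simp add: unimodular_mult_cnj)
  show ?thesis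
    unfolding disk_mobius_def[of "cnj a"] 1 2 using d one_minus_cnj_mult_nonzero by simp
qed

lemma disk_mobius_has_field_derivative:
  assumes "cmod z < 1"
  shows "(disk_mobius a t has_field_derivative - a * of_real (1 - (cmod t)\<^sup>2) / (1 - a * cnj t * z)\<^sup>2) (at z within S)"
proof -
  have d: "1 - a * cnj t * z \<noteq> 0" by (rule mobius_denom_nonzero[OF assms])
  have "((\<lambda>z. (t - a * z) / (1 - a * cnj t * z)) has_field_derivative
     ((- a) * (1 - a * cnj t * z) - (t - a * z) * (- (a * cnj t))) / ((1 - a * cnj t * z) * (1 - a * cnj t * z))) (at z within S)"
    using d by (auto intro!: derivative_eq_intros)
  also have "(- a) * (1 - a * cnj t * z) - (t - a * z) * (- (a * cnj t)) = - a * of_real (1 - (cmod t)\<^sup>2)"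
    by (simp add: complex_norm_square algebra_simps del: of_real_power)
  finally show ?thesis
    by (simp add: disk_mobius_def[abs_def] power2_eq_square)
qed

end

lemma borel_measurable_disk_mobius [measurable]: "disk_mobius a t \<in> borel_measurable borel"
  unfolding disk_mobius_def[abs_def] by measurable

lemma borel_measurable_mobius_jacobian [measurable]: "mobius_jacobian a t \<in> borel_measurable borel"
  unfolding mobius_jacobian_def[abs_def] by measurable

section \<open>Normalized area measure on the disk\<close>

lemma emeasure_disk: "emeasure lborel (ball (0::complex) 1) \<noteq> 0" "emeasure lborel (ball (0::complex) 1) \<noteq> \<infinity>"
proof -
  show "emeasure lborel (ball (0::complex) 1) \<noteq> \<infinity>"
    using emeasure_lborel_ball_finite[of "0::complex" 1] by (simp add: less_top)
  show "emeasure lborel (ball (0::complex) 1) \<noteq> 0"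
    using open_not_negligible[of "ball (0::complex) 1"] emeasure_lborel_ball_finite[of "0::complex" 1]
    by (auto simp: negligible_iff_emeasure0)
qed

lemma sets_disk_area [simp, measurable_cong]: "sets disk_area = sets borel"
  by (simp add: disk_area_def)

lemma space_disk_area [simp]: "space disk_area = UNIV"
  by (simp add: disk_area_def)

lemma finite_measure_disk_area: "finite_measure disk_area"
proof
  show "emeasure disk_area (space disk_area) \<noteq> \<infinity>"
    using emeasure_disk by (simp add: disk_area_def ennreal_divide_eq_top_iff)
qed

lemma emeasure_disk_area_UNIV: "emeasure disk_area UNIV = 1"
  using emeasure_disk by (simp add: disk_area_def ennreal_divide_self less_top)

lemma nn_integral_disk_area:
  assumes [measurable]: "h \<in> borel_measurable borel"
  shows "(\<integral>\<^sup>+z. h z \<partial>disk_area) = (\<integral>\<^sup>+z. h z * indicator (ball 0 1) z \<partial>lborel) / emeasure lborel (ball (0::complex) 1)"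
  unfolding disk_area_def by (rule nn_integral_uniform_measure) auto

text \<open>The two measures are compared set by set, where the area formula
  \<open>emeasure_holomorphic_image\<close> applies; the normalizing constant of
  \<open>disk_area\<close> is the same on both sides.\<close>

lemma nn_integral_disk_mobius:
  assumes a: "cmod a = 1" and t: "cmod t < 1" and [measurable]: "h \<in> borel_measurable borel"
  shows "(\<integral>\<^sup>+z. h (disk_mobius a t z) * ennreal ((mobius_jacobian a t z)\<^sup>2) \<partial>disk_area) = (\<integral>\<^sup>+z. h z \<partial>disk_area)"
proof -
  let ?D = "ball (0::complex) 1"
  let ?M = "density lborel (\<lambda>z. ennreal ((mobius_jacobian a t z)\<^sup>2) * indicator ?D z)"
  have [measurable]: "?D \<in> sets borel" by simp
  have eq: "distr ?M borel (disk_mobius a t) = density lborel (indicator ?D)"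
  proof (rule measure_eqI)
    fix A assume "A \<in> sets (distr ?M borel (disk_mobius a t))"
    then have A [measurable]: "A \<in> sets borel" by simp
    \<comment> \<open>The part of the disk that is carried into \<open>A\<close>; the inverse map
      shows that its image is all of \<open>?D \<inter> A\<close>.\<close>
    define S where "S = ?D \<inter> disk_mobius a t -` A"
    have S [measurable]: "S \<in> sets borel"
      unfolding S_def using measurable_sets[OF borel_measurable_disk_mobius A] by auto
    have a': "cmod (cnj a) = 1" and t': "cmod (cnj a * t) < 1"
      using a t by (simp_all add: norm_mult)
    have im: "disk_mobius a t ` S = ?D \<inter> A"
    proof (intro equalityI subsetI)
      fix w assume "w \<in> disk_mobius a t ` S"
      then show "w \<in> ?D \<inter> A" using norm_disk_mobius_less_1[OF a t] by (auto simp: S_def)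
    next
      fix w assume w: "w \<in> ?D \<inter> A"
      let ?z = "disk_mobius (cnj a) (cnj a * t) w"
      have "cmod w < 1" using w by auto
      then have 1: "cmod ?z < 1" by (rule norm_disk_mobius_less_1[OF a' t'])
      have "disk_mobius (cnj (cnj a)) (cnj (cnj a) * (cnj a * t)) ?z = w"
        using \<open>cmod w < 1\<close> by (rule disk_mobius_inverse[OF a' t'])
      moreover have "cnj (cnj a) * (cnj a * t) = t"
        using unimodular_mult_cnj[OF a t] by (simp add: mult.assoc[symmetric])
      ultimately have 2: "disk_mobius a t ?z = w" by (simp only: complex_cnj_cnj)
      show "w \<in> disk_mobius a t ` S"
        using 1 2 w by (intro image_eqI[of _ _ ?z]) (auto simp: S_def)
    qed
    have inj: "inj_on (disk_mobius a t) S"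
      by (rule inj_on_inverseI[where g = "disk_mobius (cnj a) (cnj a * t)"])
         (auto simp: S_def intro: disk_mobius_inverse[OF a t])
    have fin: "emeasure lborel (?D \<inter> A) < \<infinity>"
      using emeasure_mono[of "?D \<inter> A" ?D lborel] emeasure_lborel_ball_finite[of "0::complex" 1]
      by (auto intro: le_less_trans)
    have "emeasure lborel (disk_mobius a t ` S) =
       (\<integral>\<^sup>+z. ennreal ((cmod (- a * of_real (1 - (cmod t)\<^sup>2) / (1 - a * cnj t * z)\<^sup>2))\<^sup>2) * indicator S z \<partial>lborel)"
    proof (rule emeasure_holomorphic_image)
      show "(disk_mobius a t has_field_derivative - a * of_real (1 - (cmod t)\<^sup>2) / (1 - a * cnj t * z)\<^sup>2) (at z within S)"
        if "z \<in> S" for z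
        using that by (intro disk_mobius_has_field_derivative[OF a t]) (auto simp: S_def)
    qed (use fin inj in \<open>simp_all add: im\<close>)
    also have "\<dots> = (\<integral>\<^sup>+z. ennreal ((mobius_jacobian a t z)\<^sup>2) * indicator S z \<partial>lborel)"
    proof -
      have "cmod (- a * of_real (1 - (cmod t)\<^sup>2) / (1 - a * cnj t * z)\<^sup>2) = \<bar>mobius_jacobian a t z\<bar>" for z
        using a by (simp only: norm_mult norm_divide norm_power norm_of_real norm_minus_cancel mobius_jacobian_def) simp
      then show ?thesis by (simp only: power2_abs)
    qed
    also have "\<dots> = emeasure (distr ?M borel (disk_mobius a t)) A"
    proof -
      have "disk_mobius a t -` A \<in> sets borel"
        using measurable_sets[OF borel_measurable_disk_mobius A] by simp
      then show ?thesis
        by (subst emeasure_distr, simp, simp, subst emeasure_density)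
           (auto simp: S_def indicator_def intro!: nn_integral_cong)
    qed
    finally have "emeasure (distr ?M borel (disk_mobius a t)) A = (\<integral>\<^sup>+z. indicator (?D \<inter> A) z \<partial>lborel)"
      by (simp add: im)
    also have "\<dots> = (\<integral>\<^sup>+z. indicator ?D z * indicator A z \<partial>lborel)"
      by (intro nn_integral_cong) (auto simp: indicator_def)
    also have "\<dots> = emeasure (density lborel (indicator ?D)) A"
      using borel_measurable_indicator[of ?D lborel] by (intro emeasure_density[symmetric]) auto
    finally show "emeasure (distr ?M borel (disk_mobius a t)) A = emeasure (density lborel (indicator ?D)) A" .
  qed simp
  have "(\<integral>\<^sup>+z. h z * indicator ?D z \<partial>lborel) = (\<integral>\<^sup>+z. h z \<partial>density lborel (indicator ?D))"
    by (subst nn_integral_density) (auto simp: mult.commute)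
  also have "\<dots> = (\<integral>\<^sup>+z. h (disk_mobius a t z) * ennreal ((mobius_jacobian a t z)\<^sup>2) * indicator ?D z \<partial>lborel)"
    unfolding eq[symmetric] by (simp add: nn_integral_distr nn_integral_density mult_ac)
  finally show ?thesis
    by (simp add: nn_integral_disk_area)
qed

section \<open>The weighted measure on the polydisk\<close>

lemma borel_measurable_vec_nth_complex [measurable]: "(\<lambda>z :: complex ^ 'n::finite. z $ j) \<in> borel_measurable borel"
  by (intro borel_measurable_continuous_onI continuous_intros)

lemma borel_measurable_vecI:
  fixes f :: "'a \<Rightarrow> complex ^ 'n::finite"
  assumes "\<And>j. (\<lambda>x. f x $ j) \<in> borel_measurable M"
  shows "f \<in> borel_measurable M"
proof (subst borel_measurable_euclidean_space, intro ballI)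
  fix b :: "complex ^ 'n" assume "b \<in> Basis"
  then obtain j u where "b = axis j u" by (auto simp: Basis_vec_def)
  then show "(\<lambda>x. f x \<bullet> b) \<in> borel_measurable M"
    using assms[of j] by (simp add: inner_axis)
qed

lemma borel_measurable_vec_lambda_PiM:
  "(\<lambda>w. \<chi> j. w j) \<in> borel_measurable (\<Pi>\<^sub>M j\<in>(UNIV :: 'n::finite set). disk_area)"
  by (rule borel_measurable_vecI) simp

lemma sets_polydisk_area [simp, measurable_cong]: "sets polydisk_area = sets borel"
  by (simp add: polydisk_area_def)

lemma space_polydisk_area [simp]: "space polydisk_area = UNIV"
  by (simp add: polydisk_area_def)

lemma nn_integral_polydisk_area_prod:
  fixes h :: "'n::finite \<Rightarrow> complex \<Rightarrow> ennreal"
  assumes [measurable]: "\<And>j. h j \<in> borel_measurable borel"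
  shows "(\<integral>\<^sup>+z. (\<Prod>j\<in>UNIV. h j (z $ j)) \<partial>polydisk_area) = (\<Prod>j\<in>UNIV. \<integral>\<^sup>+u. h j u \<partial>disk_area)"
proof -
  interpret finite_measure disk_area by (rule finite_measure_disk_area)
  interpret product_sigma_finite "\<lambda>_ :: 'n. disk_area" ..
  show ?thesis
    unfolding polydisk_area_def
    by (subst nn_integral_distr[OF borel_measurable_vec_lambda_PiM])
       (auto intro!: product_nn_integral_prod)
qed

lemma polydisk_iff: "z \<in> polydisk \<longleftrightarrow> (\<forall>j. cmod (z $ j) < 1)"
  by (simp add: polydisk_def)

lemma polydiskD: "z \<in> polydisk \<Longrightarrow> cmod (z $ j) < 1"
  by (simp add: polydisk_def)

lemma open_polydisk: "open (polydisk :: (complex ^ 'n::finite) set)"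
proof -
  have "open (\<Inter>j. (\<lambda>z :: complex ^ 'n. z $ j) -` ball 0 1)"
    by (intro open_INT ballI open_vimage) (auto intro: continuous_intros)
  also have "(\<Inter>j. (\<lambda>z :: complex ^ 'n. z $ j) -` ball 0 1) = polydisk"
    by (auto simp: polydisk_def)
  finally show ?thesis .
qed

lemma sets_borel_polydisk [measurable]: "(polydisk :: (complex ^ 'n::finite) set) \<in> sets borel"
  using open_polydisk by (rule borel_open)

text \<open>A box in \<open>complex ^ 'n\<close> is a product of coordinate boxes, and boxes form an
  intersection-stable generator of the Borel sets.\<close>

lemma measure_eqI_vec:
  fixes M N :: "(complex ^ 'n::finite) measure"
  assumes M: "sets M = sets borel" and N: "sets N = sets borel"
    and fin: "emeasure M UNIV \<noteq> \<infinity>"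
    and eq: "\<And>A. (\<And>j. A j \<in> sets borel) \<Longrightarrow> emeasure M {z. \<forall>j. z $ j \<in> A j} = emeasure N {z. \<forall>j. z $ j \<in> A j}"
  shows "M = N"
proof (rule measure_eqI_generator_eq)
  let ?E = "range (\<lambda>(a, b). box a b :: (complex ^ 'n) set)"
  show "Int_stable ?E"
    by (auto simp: Int_stable_def box_Int_box)
  show "?E \<subseteq> Pow UNIV" "sets M = sigma_sets UNIV ?E" "sets N = sigma_sets UNIV ?E"
    by (simp_all add: borel_eq_box M N)
  let ?A = "\<lambda>n::nat. box (- (real n *\<^sub>R One)) (real n *\<^sub>R One) :: (complex ^ 'n) set"
  show "range ?A \<subseteq> ?E" "(\<Union>i. ?A i) = UNIV"
    unfolding UN_box_eq_UNIV by auto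
  have "emeasure M (?A i) \<le> emeasure M UNIV" for i
    by (intro emeasure_mono) (auto simp: M)
  then show "emeasure M (?A i) \<noteq> \<infinity>" for i
    using fin by (metis infinity_ennreal_def neq_top_trans)
  show "emeasure M X = emeasure N X" if "X \<in> ?E" for X
  proof -
    from that obtain a b where X: "X = box a b" by auto
    have "X = {z. \<forall>j. z $ j \<in> box (a $ j) (b $ j)}"
      by (auto simp: X box_def Basis_vec_def inner_axis)
    then show ?thesis using eq[of "\<lambda>j. box (a $ j) (b $ j)"] by simp
  qed
qed

text \<open>The cutoff to the disk is part of the weight, so that the density of the Bergman measure
  factors over the coordinates together with the indicator of the polydisk.\<close>

definition disk_weight :: "nat \<Rightarrow> complex \<Rightarrow> ennreal" where
  "disk_weight n u = indicator (ball 0 1) u * ennreal ((1 + real n) * (1 - (cmod u)\<^sup>2) ^ n)"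

lemma borel_measurable_disk_weight [measurable]: "disk_weight n \<in> borel_measurable borel"
proof -
  have [measurable]: "ball (0::complex) 1 \<in> sets borel" by simp
  show ?thesis unfolding disk_weight_def[abs_def] by measurable
qed

text \<open>Of the \<open>n + 2\<close> Jacobian factors, \<open>n\<close> turn the weight at
  \<open>u\<close> into the weight at the image point, and two account for the area.\<close>

lemma nn_integral_disk_weight_mobius:
  assumes a: "cmod a = 1" and t: "cmod t < 1" and A [measurable]: "A \<in> sets borel"
  shows "(\<integral>\<^sup>+u. disk_weight n u * (ennreal (mobius_jacobian a t u ^ (n + 2)) * indicator A (disk_mobius a t u)) \<partial>disk_area)
       = (\<integral>\<^sup>+u. disk_weight n u * indicator A u \<partial>disk_area)" (is "?L = ?R")
proof -
  have "?L = (\<integral>\<^sup>+u. (\<lambda>v. disk_weight n v * indicator A v) (disk_mobius a t u) * ennreal ((mobius_jacobian a t u)\<^sup>2) \<partial>disk_area)"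
    apply (subst (1 2) nn_integral_disk_area)
      apply measurable
    apply (rule arg_cong[where f = "\<lambda>x. x / _"])
    apply (rule nn_integral_cong)
    subgoal for u
      using norm_disk_mobius_less_1[OF a t, of u] mobius_jacobian_pos[OF a t, of u] one_minus_norm_disk_mobius[OF a t, of u]
      by (auto simp: indicator_def disk_weight_def power_add power_mult_distrib ennreal_mult'[symmetric] ennreal_mult''[symmetric] power2_eq_square mult_ac)
    done
  also have "\<dots> = ?R"
    by (rule nn_integral_disk_mobius[OF a t]) measurable
  finally show ?thesis .
qed

definition bergman_measure :: "nat ^ 'n \<Rightarrow> (complex ^ 'n::finite) measure" where
  "bergman_measure l = density polydisk_area (\<lambda>z. indicator polydisk z * ennreal (bergman_weight l z))"

lemma sets_bergman_measure [simp, measurable_cong]: "sets (bergman_measure l) = sets borel"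
  by (simp add: bergman_measure_def)

lemma space_bergman_measure [simp]: "space (bergman_measure l) = UNIV"
  by (simp add: bergman_measure_def)

lemma borel_measurable_bergman_weight [measurable]: "bergman_weight l \<in> borel_measurable borel"
  unfolding bergman_weight_def[abs_def] by measurable

lemma bergman_weight_pos: "z \<in> polydisk \<Longrightarrow> bergman_weight l z > 0"
  unfolding bergman_weight_def
  by (intro prod_pos mult_pos_pos zero_less_power ballI) (auto simp: polydisk_iff abs_square_less_1)

lemma bergman_density_eq_prod:
  "indicator polydisk z * ennreal (bergman_weight l z) = (\<Prod>j\<in>UNIV. disk_weight (l $ j) (z $ j))"
proof (cases "z \<in> polydisk")
  case True
  then have "cmod (z $ j) < 1" for j by (rule polydiskD)
  then show ?thesis
    using True unfolding bergman_weight_def disk_weight_def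
    by (subst prod_ennreal[symmetric]) (auto simp: abs_square_le_1 less_imp_le)
next
  case False
  then obtain j where "\<not> cmod (z $ j) < 1" by (auto simp: polydisk_iff)
  then have "disk_weight (l $ j) (z $ j) = 0" by (simp add: disk_weight_def)
  then have "(\<Prod>j\<in>UNIV. disk_weight (l $ j) (z $ j)) = 0" by (intro prod_zero) auto
  with False show ?thesis by simp
qed

lemma nn_integral_bergman_measure:
  assumes [measurable]: "h \<in> borel_measurable borel"
  shows "(\<integral>\<^sup>+z. h z \<partial>bergman_measure l) = (\<integral>\<^sup>+z. (\<Prod>j\<in>UNIV. disk_weight (l $ j) (z $ j)) * h z \<partial>polydisk_area)"
  unfolding bergman_measure_def by (subst nn_integral_density) (auto simp: bergman_density_eq_prod)

definition polydisk_mobius :: "('n \<Rightarrow> 'n) \<Rightarrow> complex ^ 'n \<Rightarrow> complex ^ 'n \<Rightarrow> complex ^ 'n \<Rightarrow> complex ^ 'n" where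
  "polydisk_mobius \<phi> a \<theta> z = (\<chi> \<kappa>. disk_mobius (a $ \<kappa>) (\<theta> $ \<kappa>) (z $ \<phi> \<kappa>))"

definition polydisk_jacobian :: "nat ^ 'n \<Rightarrow> ('n \<Rightarrow> 'n) \<Rightarrow> complex ^ 'n \<Rightarrow> complex ^ 'n \<Rightarrow> complex ^ 'n \<Rightarrow> real" where
  "polydisk_jacobian l \<phi> a \<theta> z = (\<Prod>j\<in>UNIV. mobius_jacobian (a $ j) (\<theta> $ j) (z $ \<phi> j) ^ (l $ j + 2))"

lemma borel_measurable_polydisk_mobius [measurable]:
  "polydisk_mobius \<phi> a \<theta> \<in> borel_measurable (borel :: (complex ^ 'n::finite) measure)"
  unfolding polydisk_mobius_def by (rule borel_measurable_vecI) simp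

lemma borel_measurable_polydisk_jacobian [measurable]:
  "polydisk_jacobian l \<phi> a \<theta> \<in> borel_measurable (borel :: (complex ^ 'n::finite) measure)"
  unfolding polydisk_jacobian_def[abs_def] by measurable

lemma emeasure_bergman_measure_UNIV: "emeasure (bergman_measure l) UNIV < \<infinity>"
proof -
  have "emeasure (bergman_measure l) UNIV = (\<integral>\<^sup>+z. 1 \<partial>bergman_measure l)"
    by simp
  also have "\<dots> = (\<Prod>j\<in>UNIV. \<integral>\<^sup>+u. disk_weight (l $ j) u \<partial>disk_area)"
    by (subst nn_integral_bergman_measure) (auto intro!: nn_integral_polydisk_area_prod)
  also have "\<dots> < \<infinity>"
  proof -
    have "(\<integral>\<^sup>+u. disk_weight n u \<partial>disk_area) \<le> (\<integral>\<^sup>+u. ennreal (1 + real n) \<partial>disk_area)" for n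
    proof (intro nn_integral_mono)
      fix u
      have "(1 + real n) * (1 - (cmod u)\<^sup>2) ^ n \<le> 1 + real n" if "cmod u < 1"
        using that by (intro mult_left_le power_le_one) (auto simp: abs_square_le_1)
      then show "disk_weight n u \<le> ennreal (1 + real n)"
        by (auto simp: disk_weight_def indicator_def intro!: ennreal_leI simp del: ennreal_plus)
    qed
    also have "\<dots> n < \<infinity>" for n
      by (simp add: emeasure_disk_area_UNIV)
    finally show ?thesis
      by (auto simp: less_top[symmetric] ennreal_prod_eq_top)
  qed
  finally show ?thesis .
qed

text \<open>On a product set both sides factor into one-variable integrals, and these agree
  coordinate by coordinate after a reindexing along \<open>\<phi>\<close>.\<close>

lemma distr_polydisk_mobius:
  fixes l :: "nat ^ 'n::finite" and a \<theta> :: "complex ^ 'n"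
  assumes \<phi>: "bij \<phi>" and l: "\<And>j. l $ \<phi> j = l $ j" and a: "\<And>j. cmod (a $ j) = 1" and \<theta>: "\<theta> \<in> polydisk"
  shows "distr (density (bergman_measure l) (\<lambda>z. ennreal (polydisk_jacobian l \<phi> a \<theta> z))) borel (polydisk_mobius \<phi> a \<theta>)
    = bergman_measure l" (is "?M = _")
proof (rule measure_eqI_vec[symmetric])
  fix A :: "'n \<Rightarrow> complex set"
  assume [measurable]: "\<And>j. A j \<in> sets borel"
  let ?E = "{z :: complex ^ 'n. \<forall>j. z $ j \<in> A j}"
  have E [measurable]: "?E \<in> sets borel" by measurable
  \<comment> \<open>Indexed by the target coordinate \<open>j\<close> but evaluated at the source
    coordinate \<open>\<phi> j\<close>; hence the \<open>inv \<phi>\<close> below.\<close>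
  define H where "H = (\<lambda>j u. disk_weight (l $ j) u *
     (ennreal (mobius_jacobian (a $ j) (\<theta> $ j) u ^ (l $ j + 2)) * indicator (A j) (disk_mobius (a $ j) (\<theta> $ j) u)))"
  have [measurable]: "H j \<in> borel_measurable borel" for j
    unfolding H_def by measurable
  have ind: "indicator ?E w = (\<Prod>j\<in>UNIV. indicator (A j) (w $ j) :: ennreal)" for w
    by (auto simp: indicator_def prod_eq_1_iff of_bool_def)
  have nn: "mobius_jacobian (a $ j) (\<theta> $ j) u \<ge> 0" for j u
    using polydiskD[OF \<theta>, of j] by (simp add: mobius_jacobian_def abs_square_le_1)
  have inv: "bij (inv \<phi>)" using \<phi> by (rule bij_imp_bij_inv)
  have "emeasure ?M ?E = (\<integral>\<^sup>+w. indicator ?E w \<partial>?M)" by simp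
  also have "\<dots> = (\<integral>\<^sup>+z. ennreal (polydisk_jacobian l \<phi> a \<theta> z) * indicator ?E (polydisk_mobius \<phi> a \<theta> z) \<partial>bergman_measure l)"
    by (simp add: nn_integral_distr nn_integral_density del: nn_integral_indicator)
  also have "\<dots> = (\<integral>\<^sup>+z. (\<Prod>j\<in>UNIV. disk_weight (l $ j) (z $ j)) *
      (ennreal (polydisk_jacobian l \<phi> a \<theta> z) * indicator ?E (polydisk_mobius \<phi> a \<theta> z)) \<partial>polydisk_area)"
    by (intro nn_integral_bergman_measure) measurable
  also have "\<dots> = (\<integral>\<^sup>+z. (\<Prod>i\<in>UNIV. H (inv \<phi> i) (z $ i)) \<partial>polydisk_area)"
  proof (intro nn_integral_cong)
    fix z :: "complex ^ 'n"
    \<comment> \<open>Here the invariance of the exponents enters: the weight of the source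
      coordinate \<open>\<phi> j\<close> has the exponent of the target coordinate
      \<open>j\<close>.\<close>
    have "(\<Prod>j\<in>UNIV. disk_weight (l $ j) (z $ j)) = (\<Prod>j\<in>UNIV. disk_weight (l $ j) (z $ \<phi> j))"
      using prod.reindex_bij_betw[OF \<phi>, of "\<lambda>j. disk_weight (l $ j) (z $ j)"] by (simp add: l)
    moreover have "ennreal (polydisk_jacobian l \<phi> a \<theta> z) =
       (\<Prod>j\<in>UNIV. ennreal (mobius_jacobian (a $ j) (\<theta> $ j) (z $ \<phi> j) ^ (l $ j + 2)))"
      unfolding polydisk_jacobian_def by (rule prod_ennreal[symmetric]) (simp add: nn)
    ultimately have "(\<Prod>j\<in>UNIV. disk_weight (l $ j) (z $ j)) *
      (ennreal (polydisk_jacobian l \<phi> a \<theta> z) * indicator ?E (polydisk_mobius \<phi> a \<theta> z)) = (\<Prod>j\<in>UNIV. H j (z $ \<phi> j))"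
      by (simp only: ind H_def prod.distrib polydisk_mobius_def vec_lambda_beta)
    also have "\<dots> = (\<Prod>i\<in>UNIV. H (inv \<phi> i) (z $ i))"
      using prod.reindex_bij_betw[OF \<phi>, of "\<lambda>i. H (inv \<phi> i) (z $ i)"] \<phi> by (simp add: bij_is_inj)
    finally show "(\<Prod>j\<in>UNIV. disk_weight (l $ j) (z $ j)) *
      (ennreal (polydisk_jacobian l \<phi> a \<theta> z) * indicator ?E (polydisk_mobius \<phi> a \<theta> z)) = (\<Prod>i\<in>UNIV. H (inv \<phi> i) (z $ i))" .
  qed
  also have "\<dots> = (\<Prod>i\<in>UNIV. \<integral>\<^sup>+u. H (inv \<phi> i) u \<partial>disk_area)"
    by (intro nn_integral_polydisk_area_prod) measurable
  also have "\<dots> = (\<Prod>j\<in>UNIV. \<integral>\<^sup>+u. H j u \<partial>disk_area)"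
    using prod.reindex_bij_betw[OF inv, of "\<lambda>j. \<integral>\<^sup>+u. H j u \<partial>disk_area"] by simp
  also have "\<dots> = (\<Prod>j\<in>UNIV. \<integral>\<^sup>+u. disk_weight (l $ j) u * indicator (A j) u \<partial>disk_area)"
    unfolding H_def using polydiskD[OF \<theta>] a
    by (intro prod.cong refl nn_integral_disk_weight_mobius) auto
  also have "\<dots> = (\<integral>\<^sup>+z. (\<Prod>j\<in>UNIV. disk_weight (l $ j) (z $ j) * indicator (A j) (z $ j)) \<partial>polydisk_area)"
    by (intro nn_integral_polydisk_area_prod[symmetric]) measurable
  also have "\<dots> = (\<integral>\<^sup>+z. indicator ?E z \<partial>bergman_measure l)"
    by (subst nn_integral_bergman_measure) (simp_all only: ind prod.distrib E borel_measurable_indicator)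
  also have "\<dots> = emeasure (bergman_measure l) ?E" by simp
  finally show "emeasure (bergman_measure l) ?E = emeasure ?M ?E" by simp
qed (use emeasure_bergman_measure_UNIV[of l] in auto)

section \<open>Holomorphic functions on the polydisk\<close>

lemma mv_holomorphic_onE:
  assumes "mv_holomorphic_on h S" "z \<in> S"
  obtains c where "(h has_derivative (\<lambda>v. \<Sum>j\<in>UNIV. c $ j * v $ j)) (at z within S)"
  using assms unfolding mv_holomorphic_on_def by blast

lemma mv_holomorphic_on_const: "mv_holomorphic_on (\<lambda>_. c) S"
  unfolding mv_holomorphic_on_def by (intro ballI exI[of _ 0]) simp

lemma mv_holomorphic_on_nth: "mv_holomorphic_on (\<lambda>z :: complex ^ 'n::finite. z $ i) S"
  unfolding mv_holomorphic_on_def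
proof (intro ballI exI[of _ "axis i 1"])
  fix z :: "complex ^ 'n"
  have "(\<lambda>v :: complex ^ 'n. \<Sum>j\<in>UNIV. axis i 1 $ j * v $ j) = (\<lambda>v. v $ i)"
    by (simp add: axis_def if_distrib[where f = "\<lambda>x. x * _"] cong: if_cong)
  then show "((\<lambda>z. z $ i) has_derivative (\<lambda>v. \<Sum>j\<in>UNIV. axis i 1 $ j * v $ j)) (at z within S)"
    by (simp add: bounded_linear_imp_has_derivative bounded_linear_vec_nth)
qed

lemma mv_holomorphic_on_mult:
  assumes "mv_holomorphic_on h S" "mv_holomorphic_on k S"
  shows "mv_holomorphic_on (\<lambda>z. h z * k z) S"
  unfolding mv_holomorphic_on_def
proof
  fix z assume z: "z \<in> S"
  obtain c where c: "(h has_derivative (\<lambda>v. \<Sum>j\<in>UNIV. c $ j * v $ j)) (at z within S)"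
    using assms(1) z by (rule mv_holomorphic_onE)
  obtain d where d: "(k has_derivative (\<lambda>v. \<Sum>j\<in>UNIV. d $ j * v $ j)) (at z within S)"
    using assms(2) z by (rule mv_holomorphic_onE)
  have "((\<lambda>z. h z * k z) has_derivative
      (\<lambda>v. \<Sum>j\<in>UNIV. (\<chi> j. h z * d $ j + c $ j * k z) $ j * v $ j)) (at z within S)"
    using has_derivative_mult[OF c d]
    by (rule has_derivative_eq_rhs)
       (simp add: sum_distrib_left sum_distrib_right sum.distrib[symmetric] algebra_simps)
  then show "\<exists>c. ((\<lambda>z. h z * k z) has_derivative (\<lambda>v. \<Sum>j\<in>UNIV. c $ j * v $ j)) (at z within S)"
    by blast
qed

lemma mv_holomorphic_on_field_compose:
  assumes "mv_holomorphic_on h S" "\<And>z. z \<in> S \<Longrightarrow> F field_differentiable (at (h z))"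
  shows "mv_holomorphic_on (\<lambda>z. F (h z)) S"
  unfolding mv_holomorphic_on_def
proof
  fix z assume z: "z \<in> S"
  obtain c where c: "(h has_derivative (\<lambda>v. \<Sum>j\<in>UNIV. c $ j * v $ j)) (at z within S)"
    using assms(1) z by (rule mv_holomorphic_onE)
  obtain D where D: "(F has_field_derivative D) (at (h z))"
    using assms(2)[OF z] unfolding field_differentiable_def by blast
  have "((\<lambda>z. F (h z)) has_derivative
      (\<lambda>v. \<Sum>j\<in>UNIV. (\<chi> j. D * c $ j) $ j * v $ j)) (at z within S)"
    using has_derivative_compose[OF c D[unfolded has_field_derivative_def]]
    by (rule has_derivative_eq_rhs) (simp add: sum_distrib_left mult.assoc)
  then show "\<exists>c. ((\<lambda>z. F (h z)) has_derivative (\<lambda>v. \<Sum>j\<in>UNIV. c $ j * v $ j)) (at z within S)"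
    by blast
qed

lemma mv_holomorphic_on_prod:
  assumes "\<And>i. i \<in> I \<Longrightarrow> mv_holomorphic_on (h i) S"
  shows "mv_holomorphic_on (\<lambda>z. \<Prod>i\<in>I. h i z) S"
  using assms
  by (induction I rule: infinite_finite_induct) (auto intro: mv_holomorphic_on_const mv_holomorphic_on_mult)

lemma has_derivative_vec_components:
  fixes g :: "'a::real_normed_vector \<Rightarrow> 'b::euclidean_space ^ 'n::finite"
  assumes "\<And>i. ((\<lambda>z. g z $ i) has_derivative G i) (at z within S)"
  shows "(g has_derivative (\<lambda>v. \<chi> i. G i v)) (at z within S)"
proof (subst has_derivative_componentwise_within, intro ballI)
  fix b :: "'b ^ 'n" assume "b \<in> Basis"
  then obtain i u where b: "b = axis i u" by (auto simp: Basis_vec_def)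
  show "((\<lambda>z. g z \<bullet> b) has_derivative (\<lambda>v. (\<chi> i. G i v) \<bullet> b)) (at z within S)"
    using has_derivative_inner_left[OF assms[of i], of u] by (simp add: b inner_axis)
qed

lemma mv_holomorphic_on_compose:
  fixes g :: "complex ^ 'n::finite \<Rightarrow> complex ^ 'm::finite"
  assumes h: "mv_holomorphic_on h T" and g: "\<And>\<kappa>. mv_holomorphic_on (\<lambda>z. g z $ \<kappa>) S" and "g ` S \<subseteq> T"
  shows "mv_holomorphic_on (\<lambda>z. h (g z)) S"
  unfolding mv_holomorphic_on_def
proof
  fix z assume z: "z \<in> S"
  have "\<forall>\<kappa>. \<exists>c :: complex ^ 'n. ((\<lambda>z. g z $ \<kappa>) has_derivative (\<lambda>v. \<Sum>j\<in>UNIV. c $ j * v $ j)) (at z within S)"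
    using g z unfolding mv_holomorphic_on_def by blast
  from choice[OF this] obtain C :: "'m \<Rightarrow> complex ^ 'n"
    where C: "\<And>\<kappa>. ((\<lambda>z. g z $ \<kappa>) has_derivative (\<lambda>v. \<Sum>j\<in>UNIV. C \<kappa> $ j * v $ j)) (at z within S)"
    by blast
  have "g z \<in> T" using assms(3) z by auto
  then obtain d where d: "(h has_derivative (\<lambda>v. \<Sum>j\<in>UNIV. d $ j * v $ j)) (at (g z) within T)"
    using h by (blast elim: mv_holomorphic_onE)
  have "((\<lambda>z. h (g z)) has_derivative (\<lambda>v. \<Sum>\<kappa>\<in>UNIV. d $ \<kappa> * (\<chi> \<kappa>. \<Sum>j\<in>UNIV. C \<kappa> $ j * v $ j) $ \<kappa>)) (at z within S)"
    by (rule has_derivative_in_compose[OF has_derivative_vec_components[OF C]])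
       (rule has_derivative_subset[OF d assms(3)])
  then have "((\<lambda>z. h (g z)) has_derivative (\<lambda>v. \<Sum>j\<in>UNIV. (\<chi> j. \<Sum>\<kappa>\<in>UNIV. d $ \<kappa> * C \<kappa> $ j) $ j * v $ j)) (at z within S)"
    by (rule has_derivative_eq_rhs)
       (simp add: sum_distrib_left sum_distrib_right mult.assoc sum.swap[of _ "UNIV :: 'n set" "UNIV :: 'm set"])
  then show "\<exists>c. ((\<lambda>z. h (g z)) has_derivative (\<lambda>v. \<Sum>j\<in>UNIV. c $ j * v $ j)) (at z within S)"
    by blast
qed

lemma mv_holomorphic_on_cong:
  assumes "\<And>z. z \<in> S \<Longrightarrow> h z = k z"
  shows "mv_holomorphic_on h S \<longleftrightarrow> mv_holomorphic_on k S"
proof -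
  have "(h has_derivative D) (at z within S) \<longleftrightarrow> (k has_derivative D) (at z within S)" if "z \<in> S" for z D
    using has_derivative_transform[of z S h k D] has_derivative_transform[of z S k h D] that assms by auto
  then show ?thesis by (simp add: mv_holomorphic_on_def)
qed

lemma mv_holomorphic_on_imp_continuous_on: "mv_holomorphic_on h S \<Longrightarrow> continuous_on S h"
  unfolding continuous_on_eq_continuous_within
  by (meson has_derivative_continuous mv_holomorphic_onE)

lemma mv_holomorphic_on_disk_mobius:
  assumes "cmod a = 1" "cmod t < 1"
  shows "mv_holomorphic_on (\<lambda>z. disk_mobius a t (z $ i)) polydisk"
proof (rule mv_holomorphic_on_field_compose[OF mv_holomorphic_on_nth])
  show "disk_mobius a t field_differentiable at (z $ i)" if "z \<in> polydisk" for z
    using disk_mobius_has_field_derivative[OF assms polydiskD[OF that], of i UNIV]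
    by (auto simp: field_differentiable_def)
qed

section \<open>The Bergman space\<close>

lemma borel_measurable_cnj [measurable (raw)]:
  assumes "f \<in> borel_measurable M"
  shows "(\<lambda>x. cnj (f x)) \<in> borel_measurable M"
  using assms by (rule measurable_compose) (intro borel_measurable_continuous_onI continuous_intros)

lemma bergman_measurable:
  assumes "\<xi> \<in> bergman l"
  shows "\<xi> \<in> borel_measurable borel"
proof -
  have "continuous_on polydisk \<xi>"
    using assms by (simp add: bergman_def mv_holomorphic_on_imp_continuous_on)
  then have "(\<lambda>z. indicator polydisk z *\<^sub>R \<xi> z) \<in> borel_measurable borel"
    by (intro borel_measurable_continuous_on_indicator) auto
  also have "(\<lambda>z. indicator polydisk z *\<^sub>R \<xi> z) = \<xi>"
    using assms by (auto simp: bergman_def indicator_def fun_eq_iff)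
  finally show ?thesis .
qed

text \<open>Indicator and weight are merged into a single real density, the form that
  \<open>integrable_density\<close> and \<open>integral_density\<close> expect.\<close>

lemma bergman_measure_eq:
  "bergman_measure l = density polydisk_area (\<lambda>z. ennreal (indicator polydisk z * bergman_weight l z))"
  unfolding bergman_measure_def
  by (intro arg_cong[where f = "density polydisk_area"] ext) (auto simp: indicator_def)

lemma AE_bergman_measure: "AE z in bergman_measure l. z \<in> polydisk"
  unfolding bergman_measure_eq by (subst AE_density) (auto simp: indicator_def)

lemma bergman_weight_nonneg: "0 \<le> indicator polydisk z * bergman_weight l z"
  using bergman_weight_pos[of z l] by (auto simp: indicator_def)

lemma integrable_bergman_measure_iff:
  fixes h :: "complex ^ 'n::finite \<Rightarrow> 'b::{banach, second_countable_topology}"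
  assumes [measurable]: "h \<in> borel_measurable borel"
  shows "integrable (bergman_measure l) h \<longleftrightarrow> integrable polydisk_area (\<lambda>z. (indicator polydisk z * bergman_weight l z) *\<^sub>R h z)"
  unfolding bergman_measure_eq
  by (rule integrable_density) (use bergman_weight_nonneg in auto)

lemma integral_bergman_measure:
  fixes h :: "complex ^ 'n::finite \<Rightarrow> 'b::{banach, second_countable_topology}"
  assumes [measurable]: "h \<in> borel_measurable borel"
  shows "(\<integral>z. h z \<partial>bergman_measure l) = (\<integral>z. (indicator polydisk z * bergman_weight l z) *\<^sub>R h z \<partial>polydisk_area)"
  unfolding bergman_measure_eq
  by (rule integral_density) (use bergman_weight_nonneg in auto)

text \<open>Membership becomes integrability against \<open>bergman_measure l\<close>, to which the
  change of variables applies. Measurability follows from holomorphy and the extension by 0.\<close>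

lemma bergman_iff:
  "\<xi> \<in> bergman l \<longleftrightarrow> mv_holomorphic_on \<xi> polydisk \<and> (\<forall>z. z \<notin> polydisk \<longrightarrow> \<xi> z = 0) \<and>
     \<xi> \<in> borel_measurable borel \<and> integrable (bergman_measure l) (\<lambda>z. (cmod (\<xi> z))\<^sup>2)"
proof -
  have "set_integrable polydisk_area polydisk (\<lambda>z. (cmod (\<xi> z))\<^sup>2 * bergman_weight l z) \<longleftrightarrow>
      integrable (bergman_measure l) (\<lambda>z. (cmod (\<xi> z))\<^sup>2)" if [measurable]: "\<xi> \<in> borel_measurable borel"
    unfolding set_integrable_def by (subst integrable_bergman_measure_iff) (simp_all add: mult_ac)
  then show ?thesis
    using bergman_measurable[of \<xi> l] unfolding bergman_def by blast
qed

lemma bergman_inner_eq: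
  assumes [measurable]: "\<xi> \<in> borel_measurable borel" "\<eta> \<in> borel_measurable borel"
  shows "bergman_inner l \<xi> \<eta> = (\<integral>z. \<xi> z * cnj (\<eta> z) \<partial>bergman_measure l)"
  unfolding bergman_inner_def set_lebesgue_integral_def
  by (subst integral_bergman_measure) (auto simp: scaleR_conv_of_real mult_ac)

lemma bergman_norm_eq:
  assumes [measurable]: "\<xi> \<in> borel_measurable borel"
  shows "bergman_norm l \<xi> = sqrt (\<integral>z. (cmod (\<xi> z))\<^sup>2 \<partial>bergman_measure l)"
  unfolding bergman_norm_def set_lebesgue_integral_def
  by (subst integral_bergman_measure) (auto simp: mult_ac)

lemma bergman_inner_commute:
  assumes "\<xi> \<in> borel_measurable borel" "\<eta> \<in> borel_measurable borel"
  shows "bergman_inner l \<eta> \<xi> = cnj (bergman_inner l \<xi> \<eta>)"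
  using Bochner_Integration.integral_cnj[of "bergman_measure l" "\<lambda>z. \<xi> z * cnj (\<eta> z)"]
  by (simp add: bergman_inner_eq assms mult.commute)

section \<open>Weighted composition with automorphisms\<close>

definition mobius_multiplier ::
    "nat ^ 'n \<Rightarrow> ('n \<Rightarrow> 'n) \<Rightarrow> complex \<Rightarrow> complex ^ 'n \<Rightarrow> complex ^ 'n \<Rightarrow> complex ^ 'n \<Rightarrow> complex" where
  "mobius_multiplier l \<phi> c a \<theta> z = c * (\<Prod>j\<in>UNIV.
      complex_of_real ((1 - (cmod (\<theta> $ j))\<^sup>2) powr (1 + real (l $ j) / 2))
      / (1 - a $ j * cnj (\<theta> $ j) * z $ \<phi> j) ^ (l $ j + 2))"

lemma powr_half_square:
  assumes "q > 0"
  shows "(q powr (1 + real n / 2))\<^sup>2 = q ^ (n + 2)"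
proof -
  have "(q powr (1 + real n / 2))\<^sup>2 = q powr ((1 + real n / 2) * 2)"
    using assms by (simp add: powr_power)
  also have "(1 + real n / 2) * 2 = real (n + 2)" by simp
  also have "q powr real (n + 2) = q ^ (n + 2)" using assms by (rule powr_realpow)
  finally show ?thesis .
qed

lemma norm_multiplier_factor:
  assumes "q > 0"
  shows "(cmod (complex_of_real (q powr (1 + real n / 2)) / d ^ (n + 2)))\<^sup>2 = (q / (cmod d)\<^sup>2) ^ (n + 2)"
proof -
  have "(cmod d ^ (n + 2))\<^sup>2 = ((cmod d)\<^sup>2) ^ (n + 2)"
    by (simp only: power_mult[symmetric] mult.commute)
  then show ?thesis
    by (simp only: norm_divide norm_power norm_of_real power_divide power2_abs powr_half_square[OF assms])
qed

locale mobius_data =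
  fixes l :: "nat ^ 'n::finite" and \<phi> :: "'n \<Rightarrow> 'n" and c :: complex and a \<theta> :: "complex ^ 'n"
  assumes bij: "bij \<phi>" and exponent: "\<And>j. l $ \<phi> j = l $ j" and c: "cmod c = 1"
    and a: "\<And>j. cmod (a $ j) = 1" and \<theta>: "\<theta> \<in> polydisk"
begin

abbreviation "mlt \<equiv> mobius_multiplier l \<phi> c a \<theta>"
abbreviation "atm \<equiv> polydisk_mobius \<phi> a \<theta>"
abbreviation "jac \<equiv> polydisk_jacobian l \<phi> a \<theta>"

lemma \<theta>_less: "cmod (\<theta> $ j) < 1"
  using \<theta> by (rule polydiskD)

lemma one_minus_\<theta>_pos: "1 - (cmod (\<theta> $ j))\<^sup>2 > 0"
  using \<theta>_less[of j] by (simp add: abs_square_less_1)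

lemma auto_in_polydisk: "z \<in> polydisk \<Longrightarrow> atm z \<in> polydisk"
  unfolding polydisk_iff polydisk_mobius_def vec_lambda_beta
  by (intro allI norm_disk_mobius_less_1 a \<theta>_less) simp

lemma jac_nonneg: "jac z \<ge> 0"
  unfolding polydisk_jacobian_def mobius_jacobian_def
  using less_imp_le[OF one_minus_\<theta>_pos]
  by (intro prod_nonneg ballI zero_le_power divide_nonneg_nonneg zero_le_power2)

lemma norm_multiplier: "(cmod (mlt z))\<^sup>2 = jac z"
proof -
  have "(cmod (mlt z))\<^sup>2 = (\<Prod>j\<in>UNIV. (cmod (complex_of_real ((1 - (cmod (\<theta> $ j))\<^sup>2) powr (1 + real (l $ j) / 2))
      / (1 - a $ j * cnj (\<theta> $ j) * z $ \<phi> j) ^ (l $ j + 2)))\<^sup>2)"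
    unfolding mobius_multiplier_def by (simp only: norm_mult c prod_norm[symmetric] prod_power_distrib mult_1)
  also have "\<dots> = jac z"
    unfolding polydisk_jacobian_def mobius_jacobian_def
    by (intro prod.cong refl norm_multiplier_factor one_minus_\<theta>_pos)
  finally show ?thesis .
qed

lemma mv_holomorphic_on_auto: "mv_holomorphic_on (\<lambda>z. atm z $ \<kappa>) polydisk"
  unfolding polydisk_mobius_def vec_lambda_beta by (intro mv_holomorphic_on_disk_mobius a \<theta>_less)

lemma mv_holomorphic_on_multiplier: "mv_holomorphic_on mlt polydisk"
  unfolding mobius_multiplier_def[abs_def]
proof (intro mv_holomorphic_on_mult mv_holomorphic_on_const mv_holomorphic_on_prod)
  fix j
  show "mv_holomorphic_on (\<lambda>z. complex_of_real ((1 - (cmod (\<theta> $ j))\<^sup>2) powr (1 + real (l $ j) / 2))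
      / (1 - a $ j * cnj (\<theta> $ j) * z $ \<phi> j) ^ (l $ j + 2)) polydisk"
  proof (rule mv_holomorphic_on_field_compose[OF mv_holomorphic_on_nth])
    fix z :: "complex ^ 'n" assume "z \<in> polydisk"
    then have "1 - a $ j * cnj (\<theta> $ j) * z $ \<phi> j \<noteq> 0"
      by (intro mobius_denom_nonzero a \<theta>_less polydiskD)
    then show "(\<lambda>u. complex_of_real ((1 - (cmod (\<theta> $ j))\<^sup>2) powr (1 + real (l $ j) / 2))
      / (1 - a $ j * cnj (\<theta> $ j) * u) ^ (l $ j + 2)) field_differentiable (at (z $ \<phi> j))"
      by (intro derivative_intros) auto
  qed
qed

lemma integrable_auto:
  fixes h :: "complex ^ 'n \<Rightarrow> 'b::{banach, second_countable_topology}"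
  assumes [measurable]: "h \<in> borel_measurable borel"
  shows "integrable (bergman_measure l) (\<lambda>z. jac z *\<^sub>R h (atm z)) \<longleftrightarrow> integrable (bergman_measure l) h"
proof -
  have "integrable (bergman_measure l) h \<longleftrightarrow>
      integrable (density (bergman_measure l) (\<lambda>z. ennreal (jac z))) (\<lambda>z. h (atm z))"
    by (subst distr_polydisk_mobius[OF bij exponent a \<theta>, symmetric], subst integrable_distr_eq) auto
  also have "\<dots> \<longleftrightarrow> integrable (bergman_measure l) (\<lambda>z. jac z *\<^sub>R h (atm z))"
    by (rule integrable_density) (auto simp: jac_nonneg)
  finally show ?thesis ..
qed

lemma integral_auto:
  fixes h :: "complex ^ 'n \<Rightarrow> 'b::{banach, second_countable_topology}"
  assumes [measurable]: "h \<in> borel_measurable borel"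
  shows "(\<integral>z. jac z *\<^sub>R h (atm z) \<partial>bergman_measure l) = (\<integral>z. h z \<partial>bergman_measure l)"
proof -
  have "(\<integral>z. h z \<partial>bergman_measure l) =
      (\<integral>z. h (atm z) \<partial>density (bergman_measure l) (\<lambda>z. ennreal (jac z)))"
    by (subst distr_polydisk_mobius[OF bij exponent a \<theta>, symmetric], subst integral_distr) auto
  also have "\<dots> = (\<integral>z. jac z *\<^sub>R h (atm z) \<partial>bergman_measure l)"
    by (rule integral_density) (auto simp: jac_nonneg)
  finally show ?thesis ..
qed

abbreviation "W \<equiv> weighted_comp mlt atm"

lemma borel_measurable_W [measurable]:
  assumes [measurable]: "\<xi> \<in> borel_measurable borel"
  shows "W \<xi> \<in> borel_measurable borel"
proof -
  have "(\<lambda>z. mlt z * \<xi> (atm z)) \<in> borel_measurable borel"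
    unfolding mobius_multiplier_def by measurable
  then show ?thesis
    unfolding weighted_comp_def by (rule measurable_If) auto
qed

lemma W_in_bergman:
  assumes \<xi>: "\<xi> \<in> bergman l"
  shows "W \<xi> \<in> bergman l"
proof -
  have [measurable]: "\<xi> \<in> borel_measurable borel" using \<xi> by (rule bergman_measurable)
  have "mv_holomorphic_on (\<lambda>z. mlt z * \<xi> (atm z)) polydisk"
  proof (rule mv_holomorphic_on_mult[OF mv_holomorphic_on_multiplier mv_holomorphic_on_compose[OF _ mv_holomorphic_on_auto]])
    show "mv_holomorphic_on \<xi> polydisk" using \<xi> by (simp add: bergman_def)
    show "atm ` polydisk \<subseteq> polydisk" using auto_in_polydisk by blast
  qed
  then have 1: "mv_holomorphic_on (W \<xi>) polydisk"
    by (rule mv_holomorphic_on_cong[THEN iffD1, rotated]) (simp add: weighted_comp_def)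
  have "integrable (bergman_measure l) (\<lambda>z. jac z *\<^sub>R (cmod (\<xi> (atm z)))\<^sup>2)"
    using \<xi> by (subst integrable_auto) (auto simp: bergman_iff)
  then have "integrable (bergman_measure l) (\<lambda>z. (cmod (W \<xi> z))\<^sup>2)"
  proof (rule integrable_cong_AE_imp)
    show "AE z in bergman_measure l. jac z *\<^sub>R (cmod (\<xi> (atm z)))\<^sup>2 = (cmod (W \<xi> z))\<^sup>2"
      using AE_bergman_measure
      by eventually_elim (simp add: weighted_comp_def norm_mult power_mult_distrib norm_multiplier)
  qed measurable
  moreover have "W \<xi> \<in> borel_measurable borel" by measurable
  moreover have "W \<xi> z = 0" if "z \<notin> polydisk" for z
    using that by (simp add: weighted_comp_def)
  ultimately show ?thesis
    using 1 unfolding bergman_iff by blast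
qed

lemma bergman_inner_W:
  assumes [measurable]: "\<xi> \<in> borel_measurable borel" "\<eta> \<in> borel_measurable borel"
  shows "bergman_inner l (W \<xi>) (W \<eta>) = bergman_inner l \<xi> \<eta>"
proof -
  have "bergman_inner l (W \<xi>) (W \<eta>) = (\<integral>z. W \<xi> z * cnj (W \<eta> z) \<partial>bergman_measure l)"
    by (rule bergman_inner_eq) measurable
  also have "\<dots> = (\<integral>z. jac z *\<^sub>R (\<xi> (atm z) * cnj (\<eta> (atm z))) \<partial>bergman_measure l)"
  proof (rule integral_cong_AE)
    show "AE z in bergman_measure l. W \<xi> z * cnj (W \<eta> z) = jac z *\<^sub>R (\<xi> (atm z) * cnj (\<eta> (atm z)))"
      using AE_bergman_measure
    proof eventually_elim
      case (elim z)
      have "complex_of_real (jac z) = mlt z * cnj (mlt z)"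
        by (simp only: norm_multiplier[symmetric] complex_norm_square)
      then show ?case using elim by (simp add: weighted_comp_def scaleR_conv_of_real)
    qed
  qed measurable
  also have "\<dots> = (\<integral>z. \<xi> z * cnj (\<eta> z) \<partial>bergman_measure l)"
    by (rule integral_auto) measurable
  finally show ?thesis by (simp add: bergman_inner_eq)
qed

end

section \<open>The inverse automorphism and unitarity\<close>

context mobius_data
begin

text \<open>The source coordinate \<open>i\<close> is recovered from the target coordinate
  \<open>inv \<phi> i\<close>, and \<open>disk_mobius_inverse\<close> supplies the parameters
  there.\<close>

abbreviation "inv_a \<equiv> \<chi> i. cnj (a $ inv \<phi> i)"
abbreviation "inv_\<theta> \<equiv> \<chi> i. cnj (a $ inv \<phi> i) * \<theta> $ inv \<phi> i"

lemma inv_\<phi> [simp]: "inv \<phi> (\<phi> j) = j" "\<phi> (inv \<phi> j) = j"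
  using bij by (simp_all add: bij_is_inj bij_is_surj surj_f_inv_f)

lemma inverse_data: "mobius_data l (inv \<phi>) (cnj c) inv_a inv_\<theta>"
proof
  show "bij (inv \<phi>)" using bij by (rule bij_imp_bij_inv)
  show "l $ inv \<phi> j = l $ j" for j using exponent[of "inv \<phi> j"] by simp
qed (auto simp: c a norm_mult polydisk_iff \<theta>_less)

lemma unimodular: "a $ j * cnj (a $ j) = 1" "cnj (a $ j) * a $ j = 1"
  using unimodular_mult_cnj[OF a, of 0] by simp_all

text \<open>Because inverting the data twice gives them back, \<open>W_R\<close> is
  \<open>R_W\<close> read in the inverse instance of the locale.\<close>

lemma inverse_inverse:
  "inv (inv \<phi>) = \<phi>" "cnj (cnj c) = c"
  "(\<chi> i. cnj (inv_a $ \<phi> i)) = a"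
  "(\<chi> i. cnj (inv_a $ \<phi> i) * inv_\<theta> $ \<phi> i) = \<theta>"
  using bij by (simp_all add: vec_eq_iff inv_inv_eq unimodular mult.assoc[symmetric])

lemma inverse_auto:
  assumes "z \<in> polydisk"
  shows "polydisk_mobius (inv \<phi>) inv_a inv_\<theta> (atm z) = z"
  using disk_mobius_inverse[OF a \<theta>_less] polydiskD[OF assms]
  by (simp add: vec_eq_iff polydisk_mobius_def)

text \<open>At \<open>atm z\<close> the denominator of the inverse multiplier is
  \<open>(1 - (cmod (\<theta> $ j))\<^sup>2) / ?d j\<close>. The powers of \<open>?d j\<close>
  therefore cancel, and the two \<open>powr\<close> factors multiply to exactly the remaining
  power.\<close>

lemma inverse_multiplier:
  assumes z: "z \<in> polydisk"
  shows "mlt z * mobius_multiplier l (inv \<phi>) (cnj c) inv_a inv_\<theta> (atm z) = 1"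
proof -
  let ?p = "\<lambda>j. complex_of_real ((1 - (cmod (\<theta> $ j))\<^sup>2) powr (1 + real (l $ j) / 2))"
  let ?d = "\<lambda>j. 1 - a $ j * cnj (\<theta> $ j) * z $ \<phi> j"
  let ?h = "\<lambda>i. complex_of_real ((1 - (cmod (inv_\<theta> $ i))\<^sup>2) powr (1 + real (l $ i) / 2))
      / (1 - inv_a $ i * cnj (inv_\<theta> $ i) * atm z $ inv \<phi> i) ^ (l $ i + 2)"
  have "(\<Prod>i\<in>UNIV. ?h i) = (\<Prod>j\<in>UNIV. ?h (\<phi> j))"
    using prod.reindex_bij_betw[OF bij, of ?h] by simp
  also have "\<dots> = (\<Prod>j\<in>UNIV. ?p j / (of_real (1 - (cmod (\<theta> $ j))\<^sup>2) / ?d j) ^ (l $ j + 2))"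
  proof (rule prod.cong)
    fix j
    have "1 - cnj (a $ j) * (a $ j * cnj (\<theta> $ j)) * atm z $ j = 1 - (cnj (a $ j) * a $ j) * cnj (\<theta> $ j) * disk_mobius (a $ j) (\<theta> $ j) (z $ \<phi> j)"
      by (simp add: polydisk_mobius_def)
    also have "\<dots> = of_real (1 - (cmod (\<theta> $ j))\<^sup>2) / ?d j"
      unfolding unimodular using mobius_denom_disk_mobius[OF a \<theta>_less] polydiskD[OF z] by simp
    finally show "?h (\<phi> j) = ?p j / (of_real (1 - (cmod (\<theta> $ j))\<^sup>2) / ?d j) ^ (l $ j + 2)"
      by (simp add: exponent norm_mult a)
  qed simp
  finally have 1: "mlt z * mobius_multiplier l (inv \<phi>) (cnj c) inv_a inv_\<theta> (atm z) =
     (c * cnj c) * (\<Prod>j\<in>UNIV. ?p j / ?d j ^ (l $ j + 2) * (?p j / (of_real (1 - (cmod (\<theta> $ j))\<^sup>2) / ?d j) ^ (l $ j + 2)))"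
    unfolding mobius_multiplier_def prod.distrib by (simp only: mult_ac)
  have 2: "?p j / ?d j ^ (l $ j + 2) * (?p j / (of_real (1 - (cmod (\<theta> $ j))\<^sup>2) / ?d j) ^ (l $ j + 2)) = 1" for j
  proof -
    have "?d j \<noteq> 0" by (intro mobius_denom_nonzero a \<theta>_less polydiskD[OF z])
    then have d: "?d j ^ (l $ j + 2) \<noteq> 0" by simp
    have q: "complex_of_real (1 - (cmod (\<theta> $ j))\<^sup>2) ^ (l $ j + 2) \<noteq> 0"
      using one_minus_\<theta>_pos[of j] by (simp del: of_real_diff of_real_power power_Suc)
    have p: "?p j * ?p j = complex_of_real (1 - (cmod (\<theta> $ j))\<^sup>2) ^ (l $ j + 2)"
      by (simp only: of_real_power[symmetric] of_real_mult[symmetric] power2_eq_square[symmetric] powr_half_square[OF one_minus_\<theta>_pos])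
    show ?thesis
      unfolding power_divide using d q
      by (simp only: times_divide_eq_left times_divide_eq_right divide_divide_eq_right p
          mult.assoc[symmetric] divide_divide_eq_left) simp
  qed
  show ?thesis
    unfolding 1 2 using c by (simp add: complex_norm_square[symmetric])
qed

abbreviation "R \<equiv> weighted_comp (mobius_multiplier l (inv \<phi>) (cnj c) inv_a inv_\<theta>) (polydisk_mobius (inv \<phi>) inv_a inv_\<theta>)"

lemma R_W:
  assumes "\<And>z. z \<notin> polydisk \<Longrightarrow> \<xi> z = 0"
  shows "W (R \<xi>) = \<xi>"
proof
  fix z show "W (R \<xi>) z = \<xi> z"
    using assms[of z] auto_in_polydisk[of z] inverse_auto[of z] inverse_multiplier[of z]
    by (auto simp: weighted_comp_def mult.assoc[symmetric])
qed

lemma W_R: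
  assumes "\<And>z. z \<notin> polydisk \<Longrightarrow> \<xi> z = 0"
  shows "R (W \<xi>) = \<xi>"
  by (rule mobius_data.R_W[OF inverse_data, unfolded inverse_inverse]) (rule assms)

lemma bergman_norm_W:
  assumes "\<xi> \<in> borel_measurable borel"
  shows "bergman_norm l (W \<xi>) = bergman_norm l \<xi>"
proof -
  have "complex_of_real (\<integral>z. (cmod (\<eta> z))\<^sup>2 \<partial>bergman_measure l) = bergman_inner l \<eta> \<eta>"
    if "\<eta> \<in> borel_measurable borel" for \<eta>
    using that by (simp add: bergman_inner_eq complex_norm_square[symmetric] del: of_real_power)
  from this[OF assms] this[OF borel_measurable_W[OF assms]] show ?thesis
    using assms by (simp add: bergman_norm_eq bergman_inner_W) (metis of_real_eq_iff)
qed

lemma bounded_op_W: "bounded_op l (bergman l, W)"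
  unfolding bounded_op_def
proof (intro conjI ballI allI exI[of _ 1])
  show "snd (bergman l, W) (\<lambda>z. \<alpha> * \<xi> z + \<beta> * \<eta> z) =
      (\<lambda>z. \<alpha> * snd (bergman l, W) \<xi> z + \<beta> * snd (bergman l, W) \<eta> z)" for \<xi> \<eta> \<alpha> \<beta>
    by (auto simp: weighted_comp_def algebra_simps)
qed (auto simp: W_in_bergman bergman_norm_W bergman_measurable)

lemma R_in_bergman: "\<xi> \<in> bergman l \<Longrightarrow> R \<xi> \<in> bergman l"
  by (rule mobius_data.W_in_bergman[OF inverse_data])

text \<open>The adjoint of an invertible isometry is its inverse: write \<open>\<eta>\<close> as
  \<open>W (R \<eta>)\<close>.\<close>

lemma bergman_inner_W_left:
  assumes "\<xi> \<in> bergman l" "\<eta> \<in> bergman l"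
  shows "bergman_inner l (W \<xi>) \<eta> = bergman_inner l \<xi> (R \<eta>)"
proof -
  have "bergman_inner l (W \<xi>) \<eta> = bergman_inner l (W \<xi>) (W (R \<eta>))"
    using assms by (subst R_W) (auto simp: bergman_def)
  also have "\<dots> = bergman_inner l \<xi> (R \<eta>)"
    using assms bergman_measurable R_in_bergman by (intro bergman_inner_W) blast+
  finally show ?thesis .
qed

lemma unitary_op_W: "unitary_op l (bergman l, W)"
proof -
  interpret inv: mobius_data l "inv \<phi>" "cnj c" inv_a inv_\<theta> by (rule inverse_data)
  have "is_adjoint l (bergman l, W) (bergman l, R)"
    by (simp add: is_adjoint_def inv.bounded_op_W bergman_inner_W_left)
  moreover have "W (R \<xi>) = \<xi> \<and> R (W \<xi>) = \<xi>" if "\<xi> \<in> bergman l" for \<xi>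
    using that by (auto simp: bergman_def R_W W_R)
  ultimately show ?thesis
    unfolding unitary_op_def using bounded_op_W by (intro conjI exI[of _ "(bergman l, R)"]) auto
qed

end

lemma weighted_comp_cong:
  assumes "\<And>z. z \<in> polydisk \<Longrightarrow> f z = f' z" "\<And>z. z \<in> polydisk \<Longrightarrow> g z = g' z"
  shows "weighted_comp f g = weighted_comp f' g'"
  using assms by (auto simp: weighted_comp_def fun_eq_iff)

section \<open>The reproducing kernel\<close>

lemma finite_measure_bergman_measure: "finite_measure (bergman_measure l)"
  using emeasure_bergman_measure_UNIV[of l] by (intro finite_measureI) auto

text \<open>This is the constant 1 in the representation by extension by 0; the kernels are obtained
  from it by moving the origin.\<close>

lemma one_in_bergman: "indicator polydisk \<in> bergman l"
proof -
  interpret finite_measure "bergman_measure l" by (rule finite_measure_bergman_measure)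
  have "integrable (bergman_measure l) (\<lambda>z. (cmod (indicator polydisk z))\<^sup>2)"
    by (rule integrable_const_bound[of _ 1]) (auto simp: indicator_def)
  moreover have "mv_holomorphic_on (indicator polydisk :: complex ^ 'a \<Rightarrow> complex) polydisk"
    by (rule mv_holomorphic_on_cong[THEN iffD2, OF _ mv_holomorphic_on_const[of 1]]) simp
  ultimately show ?thesis by (auto simp: bergman_iff)
qed

lemma measure_bergman_measure_pos: "measure (bergman_measure l) UNIV > 0"
proof -
  interpret finite_measure "bergman_measure l" by (rule finite_measure_bergman_measure)
  have "emeasure (bergman_measure l) UNIV \<noteq> 0"
  proof
    assume "emeasure (bergman_measure l) UNIV = 0"
    then have "(\<Prod>j\<in>UNIV. \<integral>\<^sup>+u. disk_weight (l $ j) u \<partial>disk_area) = 0"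
      using nn_integral_bergman_measure[of "\<lambda>_. 1" l] nn_integral_polydisk_area_prod[of "\<lambda>j. disk_weight (l $ j)"] by simp
    then obtain n where "(\<integral>\<^sup>+u. disk_weight n u \<partial>disk_area) = 0" by auto
    then have "AE u in disk_area. disk_weight n u = 0"
      by (subst (asm) nn_integral_0_iff_AE) auto
    moreover have "AE u in disk_area. u \<in> ball 0 1"
      unfolding disk_area_def by (intro AE_uniform_measureI) auto
    ultimately have "AE u in disk_area. False"
    proof eventually_elim
      case (elim u)
      then have "(1 + real n) * (1 - (cmod u)\<^sup>2) ^ n \<le> 0"
        by (simp add: disk_weight_def ennreal_eq_0_iff del: mult_le_0_iff)
      moreover have "(1 + real n) * (1 - (cmod u)\<^sup>2) ^ n > 0"
        using elim by (intro mult_pos_pos zero_less_power) (auto simp: abs_square_less_1)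
      ultimately show False by simp
    qed
    then have "emeasure disk_area (space disk_area) = 0"
      by (subst (asm) AE_iff_measurable[of "space disk_area"]) auto
    then show False by (simp add: emeasure_disk_area_UNIV)
  qed
  then show ?thesis by (simp add: emeasure_eq_measure zero_less_measure_iff)
qed

lemma bergman_integrable:
  assumes "\<xi> \<in> bergman l"
  shows "integrable (bergman_measure l) \<xi>"
proof -
  interpret finite_measure "bergman_measure l" by (rule finite_measure_bergman_measure)
  have "integrable (bergman_measure l) (\<lambda>z. 1 + (cmod (\<xi> z))\<^sup>2)"
    using assms by (simp add: bergman_iff)
  then show ?thesis
  proof (rule Bochner_Integration.integrable_bound)
    show "AE z in bergman_measure l. cmod (\<xi> z) \<le> norm (1 + (cmod (\<xi> z))\<^sup>2)"
    proof (intro AE_I2)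
      fix z
      \<comment> \<open>Completing the square in \<open>x\<^sup>2 - x + 1\<close> bounds
        \<open>x\<close> by \<open>1 + x\<^sup>2\<close>, which is integrable because the measure is
        finite.\<close>
      have "0 \<le> (cmod (\<xi> z) - 1/2)\<^sup>2 + 3/4" by simp
      then have "cmod (\<xi> z) \<le> 1 + (cmod (\<xi> z))\<^sup>2"
        by (simp add: power2_eq_square algebra_simps)
      then show "cmod (\<xi> z) \<le> norm (1 + (cmod (\<xi> z))\<^sup>2)" by simp
    qed
  qed (use bergman_measurable[OF assms] in measurable)
qed

text \<open>On the complex line through 0 and \<open>z\<close> the function restricts to a
  holomorphic function of one variable on the closed unit disk. Cauchy's formula on the unit circle
  applies, and \<open>u = exp (2 * pi * \<i> * t)\<close> turns \<open>du / u\<close> into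
  \<open>2 * pi * \<i> * dt\<close>.\<close>

lemma circle_mean_value:
  assumes \<xi>: "mv_holomorphic_on \<xi> polydisk" and z: "z \<in> polydisk"
  shows "((\<lambda>t. \<xi> (\<chi> j. exp (2 * of_real pi * \<i> * of_real t) * z $ j)) has_integral \<xi> 0) {0..1}"
proof -
  have in_polydisk: "(\<chi> j. u * z $ j) \<in> polydisk" if "cmod u \<le> 1" for u
  proof -
    have "cmod (u * z $ j) < 1" for j
      using that mult_mono[of "cmod u" 1 "cmod (z $ j)" "cmod (z $ j)"] polydiskD[OF z, of j] by (simp add: norm_mult)
    then show ?thesis by (simp add: polydisk_iff)
  qed
  define F where "F u = \<xi> (\<chi> j. u * z $ j)" for u
  have "F holomorphic_on cball 0 1"
    unfolding holomorphic_on_def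
  proof
    fix u :: complex assume u: "u \<in> cball 0 1"
    have "(\<chi> j. u * z $ j) \<in> polydisk" using u by (intro in_polydisk) auto
    with \<xi> obtain c where c: "(\<xi> has_derivative (\<lambda>v. \<Sum>j\<in>UNIV. c $ j * v $ j)) (at (\<chi> j. u * z $ j) within polydisk)"
      by (rule mv_holomorphic_onE)
    have d: "((\<lambda>u. \<chi> j. u * z $ j) has_derivative (\<lambda>v. \<chi> j. v * z $ j)) (at u within cball 0 1)"
      by (rule has_derivative_vec_components) (auto intro!: derivative_eq_intros)
    have "(\<lambda>u. \<chi> j. u * z $ j) ` cball 0 1 \<subseteq> polydisk" using in_polydisk by auto
    from has_derivative_in_compose[OF d has_derivative_subset[OF c this]]
    have "(F has_derivative (\<lambda>v. \<Sum>j\<in>UNIV. c $ j * (v * z $ j))) (at u within cball 0 1)"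
      by (simp add: F_def[abs_def])
    then have "(F has_field_derivative (\<Sum>j\<in>UNIV. c $ j * z $ j)) (at u within cball 0 1)"
      unfolding has_field_derivative_def
      by (rule has_derivative_eq_rhs) (simp add: fun_eq_iff sum_distrib_left mult_ac)
    then show "F field_differentiable at u within cball 0 1"
      by (auto simp: field_differentiable_def)
  qed
  from Cauchy_integral_circlepath_simple[OF this, of 0]
  have "((\<lambda>u. F u / u) has_contour_integral (2 * of_real pi * \<i> * F 0)) (circlepath 0 1)"
    by simp
  then have "((\<lambda>t. F (exp (2 * of_real pi * \<i> * of_real t)) / exp (2 * of_real pi * \<i> * of_real t) *
      (2 * of_real pi * \<i> * exp (2 * of_real pi * \<i> * of_real t))) has_integral (2 * of_real pi * \<i> * F 0)) {0..1}"
    unfolding has_contour_integral_def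
    by (rule has_integral_eq[rotated]) (simp add: vector_derivative_circlepath01, simp add: circlepath)
  then have "((\<lambda>t. 1 / (2 * of_real pi * \<i>) * (F (exp (2 * of_real pi * \<i> * of_real t)) / exp (2 * of_real pi * \<i> * of_real t) *
      (2 * of_real pi * \<i> * exp (2 * of_real pi * \<i> * of_real t)))) has_integral 1 / (2 * of_real pi * \<i>) * (2 * of_real pi * \<i> * F 0)) {0..1}"
    by (rule has_integral_mult_right)
  then show ?thesis
    by (simp add: F_def vec_eq_iff zero_vec_def)
qed

definition polydisk_rotate :: "real \<Rightarrow> complex ^ 'n \<Rightarrow> complex ^ 'n" where
  "polydisk_rotate t z = (\<chi> j. exp (2 * of_real pi * \<i> * of_real t) * z $ j)"

text \<open>The minus sign compensates for \<open>disk_mobius a 0 z = - a * z\<close>.\<close>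

lemma rotation_data: "mobius_data l id 1 (\<chi> j. - exp (2 * of_real pi * \<i> * of_real t)) 0"
  by unfold_locales (auto simp: polydisk_iff)

lemma polydisk_mobius_rotate: "polydisk_mobius id (\<chi> j. - exp (2 * of_real pi * \<i> * of_real t)) 0 = polydisk_rotate t"
  by (auto simp: fun_eq_iff vec_eq_iff polydisk_mobius_def disk_mobius_def polydisk_rotate_def)

lemma polydisk_jacobian_rotate: "polydisk_jacobian l id (\<chi> j. - exp (2 * of_real pi * \<i> * of_real t)) 0 z = 1"
  by (auto simp: polydisk_jacobian_def mobius_jacobian_def)

lemma integrable_rotate:
  fixes h :: "complex ^ 'n::finite \<Rightarrow> 'b::{banach, second_countable_topology}"
  assumes "h \<in> borel_measurable borel"
  shows "integrable (bergman_measure l) (\<lambda>z. h (polydisk_rotate t z)) \<longleftrightarrow> integrable (bergman_measure l) h"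
  using mobius_data.integrable_auto[OF rotation_data assms, of l t]
  by (simp add: polydisk_mobius_rotate polydisk_jacobian_rotate)

lemma integral_rotate:
  fixes h :: "complex ^ 'n::finite \<Rightarrow> 'b::{banach, second_countable_topology}"
  assumes "h \<in> borel_measurable borel"
  shows "(\<integral>z. h (polydisk_rotate t z) \<partial>bergman_measure l) = (\<integral>z. h z \<partial>bergman_measure l)"
  using mobius_data.integral_auto[OF rotation_data assms, of l t]
  by (simp add: polydisk_mobius_rotate polydisk_jacobian_rotate)

lemma polydisk_rotate_in_polydisk: "z \<in> polydisk \<Longrightarrow> polydisk_rotate t z \<in> polydisk"
  by (simp add: polydisk_iff polydisk_rotate_def norm_mult)

lemma circle_average:
  assumes \<xi>: "mv_holomorphic_on \<xi> polydisk" and z: "z \<in> polydisk"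
  shows "(\<integral>t. indicator {0..1} t *\<^sub>R \<xi> (polydisk_rotate t z) \<partial>lborel) = \<xi> 0"
proof -
  have "continuous_on {0..1} (\<lambda>t. \<xi> (polydisk_rotate t z))"
  proof (rule continuous_on_compose2[OF mv_holomorphic_on_imp_continuous_on[OF \<xi>]])
    show "continuous_on {0..1} (\<lambda>t. polydisk_rotate t z)"
      unfolding polydisk_rotate_def by (intro continuous_intros)
  qed (use polydisk_rotate_in_polydisk[OF z] in auto)
  then have "set_integrable lborel {0..1} (\<lambda>t. \<xi> (polydisk_rotate t z))"
    unfolding set_integrable_def by (intro borel_integrable_compact) auto
  then have "(LINT t:{0..1}|lborel. \<xi> (polydisk_rotate t z)) = integral {0..1} (\<lambda>t. \<xi> (polydisk_rotate t z))"
    by (rule set_borel_integral_eq_integral)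
  also have "\<dots> = \<xi> 0"
    using circle_mean_value[OF assms] by (simp add: polydisk_rotate_def integral_unique)
  finally show ?thesis by (simp add: set_lebesgue_integral_def)
qed

text \<open>Averaging over the simultaneous rotations of all coordinates reduces this to Cauchy's formula on circles.\<close>

lemma bergman_integral_eq_value_0:
  assumes \<xi>: "\<xi> \<in> bergman l"
  shows "(\<integral>z. \<xi> z \<partial>bergman_measure l) = of_real (measure (bergman_measure l) UNIV) * \<xi> 0"
proof -
  interpret P: finite_measure "bergman_measure l" by (rule finite_measure_bergman_measure)
  interpret pair_sigma_finite lborel "bergman_measure l" ..
  have [measurable]: "\<xi> \<in> borel_measurable borel" using \<xi> by (rule bergman_measurable)
  have int: "integrable (bergman_measure l) \<xi>" using \<xi> by (rule bergman_integrable)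
  let ?f = "\<lambda>(t, z). indicator {0..1::real} t *\<^sub>R \<xi> (polydisk_rotate t z)"
  have [measurable]: "(\<lambda>(t, z). polydisk_rotate t z) \<in> borel_measurable (lborel \<Otimes>\<^sub>M bergman_measure l)"
    unfolding polydisk_rotate_def split_beta by (rule borel_measurable_vecI) simp
  have "integrable (lborel \<Otimes>\<^sub>M bergman_measure l) ?f"
  proof (rule Fubini_integrable)
    show "?f \<in> borel_measurable (lborel \<Otimes>\<^sub>M bergman_measure l)"
      by measurable
    \<comment> \<open>By rotation invariance the inner integral is the same for every
      \<open>t\<close> in \<open>{0..1}\<close>, so its integrability in \<open>t\<close> is
      immediate.\<close>
    have "(\<lambda>t. \<integral>z. norm (?f (t, z)) \<partial>bergman_measure l) =
        (\<lambda>t. indicator {0..1} t *\<^sub>R (\<integral>z. cmod (\<xi> z) \<partial>bergman_measure l))"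
      using integral_rotate[of "\<lambda>z. cmod (\<xi> z)" l] by (auto simp: fun_eq_iff indicator_def)
    then show "integrable lborel (\<lambda>t. \<integral>z. norm (?f (t, z)) \<partial>bergman_measure l)"
      by simp
    show "AE t in lborel. integrable (bergman_measure l) (\<lambda>z. ?f (t, z))"
      using integrable_rotate[of \<xi> l] int by simp
  qed
  from Fubini_integral[OF this]
  have "(\<integral>z. (\<integral>t. indicator {0..1} t *\<^sub>R \<xi> (polydisk_rotate t z) \<partial>lborel) \<partial>bergman_measure l) =
      (\<integral>t. (\<integral>z. indicator {0..1::real} t *\<^sub>R \<xi> (polydisk_rotate t z) \<partial>bergman_measure l) \<partial>lborel)"
    by simp
  also have "\<dots> = (\<integral>t. indicator {0..1::real} t *\<^sub>R (\<integral>z. \<xi> z \<partial>bergman_measure l) \<partial>lborel)"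
    using integral_rotate[of \<xi> l] by simp
  also have "\<dots> = (\<integral>z. \<xi> z \<partial>bergman_measure l)"
    by simp
  also have "(\<integral>z. (\<integral>t. indicator {0..1} t *\<^sub>R \<xi> (polydisk_rotate t z) \<partial>lborel) \<partial>bergman_measure l) =
      (\<integral>z. \<xi> 0 \<partial>bergman_measure l)"
  proof (rule integral_cong_AE)
    show "AE z in bergman_measure l. (\<integral>t. indicator {0..1} t *\<^sub>R \<xi> (polydisk_rotate t z) \<partial>lborel) = \<xi> 0"
      using AE_bergman_measure by eventually_elim (use \<xi> in \<open>simp add: bergman_def circle_average\<close>)
    show "(\<lambda>z. \<integral>t. indicator {0..1} t *\<^sub>R \<xi> (polydisk_rotate t z) \<partial>lborel) \<in> borel_measurable (bergman_measure l)"
    proof (rule lborel.borel_measurable_lebesgue_integral)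
      have "(\<lambda>(z, t). polydisk_rotate t z) \<in> borel_measurable (bergman_measure l \<Otimes>\<^sub>M lborel)"
        unfolding polydisk_rotate_def split_beta by (rule borel_measurable_vecI) simp
      then show "(\<lambda>(z, t). indicator {0..1::real} t *\<^sub>R \<xi> (polydisk_rotate t z)) \<in> borel_measurable (bergman_measure l \<Otimes>\<^sub>M lborel)"
        by measurable
    qed
  qed simp
  finally show ?thesis by (simp add: scaleR_conv_of_real)
qed

text \<open>The reproducing kernel, up to the factor \<open>measure (bergman_measure l) UNIV\<close> (which is \<open>1\<close>, but only
  its positivity matters here).\<close>

definition bergman_kernel :: "nat ^ 'n \<Rightarrow> complex ^ 'n \<Rightarrow> complex ^ 'n \<Rightarrow> complex" where
  "bergman_kernel l w z =
     (if z \<in> polydisk then \<Prod>j\<in>UNIV. 1 / (1 - cnj (w $ j) * z $ j) ^ (l $ j + 2) else 0)"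

lemma bergman_scale:
  assumes "\<xi> \<in> bergman l"
  shows "(\<lambda>z. \<alpha> * \<xi> z) \<in> bergman l"
proof -
  have [measurable]: "\<xi> \<in> borel_measurable borel" using assms by (rule bergman_measurable)
  show ?thesis
    using assms unfolding bergman_iff
    by (auto simp: norm_mult power_mult_distrib intro: mv_holomorphic_on_mult mv_holomorphic_on_const)
qed

text \<open>The involution swapping 0 and \<open>w\<close> has the data \<open>a = 1\<close>,
  \<open>\<theta> = w\<close>. Its operator takes the constant 1 to \<open>p\<close> times the
  kernel at \<open>w\<close>, and takes \<open>\<xi>\<close> to a function with value
  \<open>p * \<xi> w\<close> at 0. Since it is unitary and its own inverse, pairing with the kernel
  becomes pairing with 1, that is, evaluation at 0.\<close>

lemma kernel_in_bergman_and_reproducing: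
  fixes l :: "nat ^ 'n::finite"
  assumes w: "w \<in> polydisk"
  shows "bergman_kernel l w \<in> bergman l \<and> (\<forall>\<xi>\<in>bergman l.
    bergman_inner l \<xi> (bergman_kernel l w) = of_real (measure (bergman_measure l) UNIV) * \<xi> w)"
proof -
  interpret D: mobius_data l id 1 "\<chi> j. 1" w
    by unfold_locales (auto simp: w)
  define p where "p = (\<Prod>j\<in>UNIV. (1 - (cmod (w $ j))\<^sup>2) powr (1 + real (l $ j) / 2))"
  have p: "p \<noteq> 0"
    unfolding p_def using D.one_minus_\<theta>_pos by (auto simp: less_le)
  have m: "mobius_multiplier l id 1 (\<chi> j. 1) w z = of_real p * (\<Prod>j\<in>UNIV. 1 / (1 - cnj (w $ j) * z $ j) ^ (l $ j + 2))" for z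
    unfolding mobius_multiplier_def p_def of_real_prod prod.distrib[symmetric] by (simp del: power_Suc)
  \<comment> \<open>The data of an involution: inverting them changes nothing, so \<open>D.R\<close>
    has the same multiplier and map as \<open>D.W\<close>.\<close>
  have inv: "inv id = id" "cnj 1 = 1" "(\<chi> i. cnj ((\<chi> j. 1) $ id i)) = (\<chi> j. 1)" "(\<chi> i. cnj ((\<chi> j. 1) $ id i) * w $ id i) = w"
    by (simp_all add: vec_eq_iff)
  have "(\<lambda>z. D.R (indicator polydisk) z) = (\<lambda>z. of_real p * bergman_kernel l w z)"
    using D.auto_in_polydisk unfolding inv
    by (auto simp: weighted_comp_def bergman_kernel_def m fun_eq_iff)
  then have R: "D.R (indicator polydisk) = (\<lambda>z. of_real p * bergman_kernel l w z)" by simp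
  have "(\<lambda>z. of_real (1 / p) * (of_real p * bergman_kernel l w z)) \<in> bergman l"
    using D.R_in_bergman[OF one_in_bergman] unfolding R by (rule bergman_scale)
  moreover have "of_real (1 / p) * (of_real p * u) = u" for u :: complex
    using p by simp
  ultimately have K: "bergman_kernel l w \<in> bergman l" by (simp only:)
  have [measurable]: "bergman_kernel l w \<in> borel_measurable borel" using K by (rule bergman_measurable)
  have "bergman_inner l \<xi> (bergman_kernel l w) = of_real (measure (bergman_measure l) UNIV) * \<xi> w" if \<xi>: "\<xi> \<in> bergman l" for \<xi>
  proof -
    have [measurable]: "\<xi> \<in> borel_measurable borel" using \<xi> by (rule bergman_measurable)
    have W: "D.W \<xi> \<in> bergman l" using \<xi> by (rule D.W_in_bergman)
    have [measurable]: "D.W \<xi> \<in> borel_measurable borel" using W by (rule bergman_measurable)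
    have "of_real p * bergman_inner l \<xi> (bergman_kernel l w) = bergman_inner l \<xi> (\<lambda>z. of_real p * bergman_kernel l w z)"
      by (simp add: bergman_inner_eq mult.left_commute)
    also have "\<dots> = bergman_inner l (D.W \<xi>) (indicator polydisk)"
      unfolding R[symmetric] using \<xi> by (intro D.bergman_inner_W_left[symmetric] one_in_bergman)
    also have "\<dots> = (\<integral>z. D.W \<xi> z \<partial>bergman_measure l)"
      unfolding bergman_inner_eq[OF bergman_measurable[OF W] bergman_measurable[OF one_in_bergman]]
      by (intro Bochner_Integration.integral_cong) (auto simp: weighted_comp_def)
    also have "\<dots> = of_real (measure (bergman_measure l) UNIV) * D.W \<xi> 0"
      using W by (rule bergman_integral_eq_value_0)
    also have "D.W \<xi> 0 = of_real p * \<xi> w"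
    proof -
      have "polydisk_mobius id (\<chi> j. 1) w 0 = w"
        by (simp add: polydisk_mobius_def disk_mobius_def vec_eq_iff)
      moreover have "(0 :: complex ^ 'n) \<in> polydisk" by (simp add: polydisk_iff)
      ultimately show ?thesis by (simp add: weighted_comp_def m)
    qed
    finally show ?thesis using p by simp
  qed
  with K show ?thesis by blast
qed

lemmas kernel_in_bergman = kernel_in_bergman_and_reproducing[THEN conjunct1]
lemmas bergman_reproducing = kernel_in_bergman_and_reproducing[THEN conjunct2, rule_format]

lemma bergman_kernel_commute:
  assumes "z \<in> polydisk" "w \<in> polydisk"
  shows "cnj (bergman_kernel l w z) = bergman_kernel l z w"
  using assms by (simp add: bergman_kernel_def mult.commute)

lemma unitary_imp_kernel_identity:
  assumes U: "unitary_op l (weighted_comp_max l f g)" and g: "g ` polydisk \<subseteq> polydisk"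
    and z: "z \<in> polydisk" and w: "w \<in> polydisk"
  shows "f w * cnj (f z) * bergman_kernel l (g z) (g w) = bergman_kernel l z w"
proof -
  let ?W = "weighted_comp f g"
  let ?k = "complex_of_real (measure (bergman_measure l) UNIV)"
  let ?K = "bergman_kernel l"
  have k: "?k \<noteq> 0" using measure_bergman_measure_pos[of l] by simp
  obtain R where adj: "is_adjoint l (weighted_comp_max l f g) R"
    and inv: "\<And>\<xi>. \<xi> \<in> bergman l \<Longrightarrow> ?W (snd R \<xi>) = \<xi>"
    using U unfolding unitary_op_def weighted_comp_max_def by auto
  have W: "?W \<xi> \<in> bergman l" if "\<xi> \<in> bergman l" for \<xi>
    using U that unfolding unitary_op_def bounded_op_def weighted_comp_max_def by auto
  have R: "snd R \<xi> \<in> bergman l" if "\<xi> \<in> bergman l" for \<xi>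
    using adj that unfolding is_adjoint_def bounded_op_def by auto
  \<comment> \<open>The image of the kernel at \<open>z\<close> is evaluated at \<open>u\<close> by
    pairing it with the kernel at \<open>u\<close>; the total mass \<open>?k\<close> occurs at both
    ends and cancels.\<close>
  have RK: "snd R (?K z) u = cnj (f z * ?K u (g z))" if u: "u \<in> polydisk" for u
  proof -
    have Kz: "?K z \<in> bergman l" and Ku: "?K u \<in> bergman l"
      using z u by (simp_all add: kernel_in_bergman)
    have "?k * snd R (?K z) u = bergman_inner l (snd R (?K z)) (?K u)"
      using bergman_reproducing[OF u R[OF Kz]] by simp
    also have "\<dots> = cnj (bergman_inner l (?K u) (snd R (?K z)))"
      using Ku R[OF Kz] by (intro bergman_inner_commute bergman_measurable)
    also have "bergman_inner l (?K u) (snd R (?K z)) = bergman_inner l (?W (?K u)) (?K z)"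
      using adj Ku Kz by (simp add: is_adjoint_def weighted_comp_max_def)
    also have "\<dots> = ?k * ?W (?K u) z"
      using bergman_reproducing[OF z W[OF Ku]] .
    also have "cnj \<dots> = ?k * cnj (f z * ?K u (g z))"
      using z by (simp add: weighted_comp_def)
    finally show ?thesis using k by simp
  qed
  have gw: "g w \<in> polydisk" and gz: "g z \<in> polydisk" using g z w by auto
  have "?K z w = ?W (snd R (?K z)) w"
    using inv[OF kernel_in_bergman[OF z]] by simp
  also have "\<dots> = f w * cnj (f z) * cnj (?K (g w) (g z))"
    using w by (simp add: weighted_comp_def RK[OF gw])
  finally show ?thesis by (simp add: bergman_kernel_commute gw gz)
qed

section \<open>Rigidity of the kernel identity\<close>

lemma zero_in_polydisk: "0 \<in> polydisk"
  by (simp add: polydisk_iff)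

lemma axis_in_polydisk: "cmod u < 1 \<Longrightarrow> axis i u \<in> polydisk"
  by (simp add: polydisk_iff axis_def)

text \<open>At \<open>z = 0\<close> every factor equals 1, so by the product rule the derivative of
  the left side along axis \<open>i\<close> is a combination of the \<open>h w $ j\<close> with
  coefficients independent of \<open>w\<close>, while that of the right side is a multiple of
  \<open>w $ i\<close>. Collecting all \<open>i\<close> gives a matrix \<open>C\<close> with
  \<open>C *v h w = w\<close>.\<close>

lemma linear_of_kernel_identity:
  fixes h :: "complex ^ 'n::finite \<Rightarrow> complex ^ 'n" and m :: "'n \<Rightarrow> nat"
  assumes h: "\<And>\<kappa>. mv_holomorphic_on (\<lambda>z. h z $ \<kappa>) polydisk" and h0: "h 0 = 0"
    and m: "\<And>j. m j > 0"
    and eq: "\<And>z w. z \<in> polydisk \<Longrightarrow> w \<in> polydisk \<Longrightarrow>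
      (\<Prod>j\<in>UNIV. (1 - h w $ j * cnj (h z $ j)) ^ m j) = (\<Prod>j\<in>UNIV. (1 - w $ j * cnj (z $ j)) ^ m j)"
  obtains B where "\<And>w. w \<in> polydisk \<Longrightarrow> h w = B *v w"
proof -
  have "\<forall>j. \<exists>c :: complex ^ 'n. ((\<lambda>z. h z $ j) has_derivative (\<lambda>v. \<Sum>k\<in>UNIV. c $ k * v $ k)) (at 0 within polydisk)"
    using h zero_in_polydisk unfolding mv_holomorphic_on_def by blast
  from choice[OF this] obtain D :: "'n \<Rightarrow> complex ^ 'n"
    where D: "\<And>j. ((\<lambda>z. h z $ j) has_derivative (\<lambda>v. \<Sum>k\<in>UNIV. D j $ k * v $ k)) (at 0 within polydisk)"
    by blast
  have ax0: "axis i (0::complex) = (0 :: complex ^ 'n)" for i by (simp add: axis_def vec_eq_iff)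
  \<comment> \<open>The parameter \<open>s\<close> is real because of the conjugation: the conjugate
    of a holomorphic function is in general only real differentiable.\<close>
  have deriv: "((\<lambda>s. cnj (h (axis i (of_real s)) $ j)) has_derivative (\<lambda>s. of_real s * cnj (D j $ i))) (at 0)" for i j
  proof -
    have "((\<lambda>s::real. axis i (of_real s) :: complex ^ 'n) has_derivative (\<lambda>s. axis i (of_real s))) (at 0)"
      by (intro bounded_linear_imp_has_derivative linear_conv_bounded_linear[THEN iffD1] linearI)
         (auto simp: axis_def vec_eq_iff complex_eq_iff)
    moreover have "((\<lambda>z. h z $ j) has_derivative (\<lambda>v. \<Sum>k\<in>UNIV. D j $ k * v $ k)) (at (axis i (of_real 0)))"
      using D[of j] unfolding at_within_open[OF zero_in_polydisk open_polydisk] ax0 of_real_0 .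
    ultimately have "((\<lambda>s. h (axis i (of_real s)) $ j) has_derivative (\<lambda>s. \<Sum>k\<in>UNIV. D j $ k * axis i (of_real s) $ k)) (at 0)"
      by (rule has_derivative_compose)
    then have "((\<lambda>s. cnj (h (axis i (of_real s)) $ j)) has_derivative (\<lambda>s. cnj (\<Sum>k\<in>UNIV. D j $ k * axis i (of_real s) $ k))) (at 0)"
      by (rule has_derivative_cnj)
    then show ?thesis
      by (rule has_derivative_eq_rhs)
         (simp add: axis_def if_distrib[where f = "\<lambda>x. _ * x"] mult.commute cong: if_cong)
  qed
  have lin: "(\<Sum>j\<in>UNIV. of_nat (m j) * h w $ j * cnj (D j $ i)) = of_nat (m i) * w $ i" if w: "w \<in> polydisk" for w i
  proof -
    have L: "((\<lambda>s. \<Prod>j\<in>UNIV. (1 - h w $ j * cnj (h (axis i (of_real s)) $ j)) ^ m j) has_derivative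
        (\<lambda>s. \<Sum>j\<in>UNIV. - (of_nat (m j) * (h w $ j * (of_real s * cnj (D j $ i)))))) (at 0)"
      by (rule has_derivative_eq_rhs[OF has_derivative_prod],
          rule has_derivative_power, rule has_derivative_diff[OF has_derivative_const],
          rule has_derivative_mult_right[OF deriv])
         (simp add: ax0 h0)
    have R: "((\<lambda>s. (1 - w $ i * of_real s) ^ m i) has_derivative (\<lambda>s. - (of_nat (m i) * (w $ i * of_real s)))) (at 0)"
      by (auto intro!: derivative_eq_intros)
    have ev: "\<forall>\<^sub>F s in at 0. (\<Prod>j\<in>UNIV. (1 - h w $ j * cnj (h (axis i (of_real s)) $ j)) ^ m j) = (1 - w $ i * of_real s) ^ m i"
    proof -
      have "(\<Prod>j\<in>UNIV. (1 - h w $ j * cnj (h (axis i (of_real s)) $ j)) ^ m j) = (1 - w $ i * of_real s) ^ m i" if "\<bar>s\<bar> < 1" for s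
      proof -
        have "(\<Prod>j\<in>UNIV. (1 - w $ j * cnj (axis i (complex_of_real s) $ j)) ^ m j) =
            (\<Prod>j\<in>UNIV. if j = i then (1 - w $ i * of_real s) ^ m i else 1)"
          by (intro prod.cong) (auto simp: axis_def)
        then show ?thesis
          using eq[of "axis i (of_real s)" w] w that by (simp add: axis_in_polydisk)
      qed
      moreover have "\<forall>\<^sub>F s in at 0. \<bar>s::real\<bar> < 1"
        by (rule eventually_at[THEN iffD2]) (auto intro!: exI[of _ 1])
      ultimately show ?thesis by (auto elim: eventually_mono)
    qed
    have "((\<lambda>s. (1 - w $ i * of_real s) ^ m i) has_derivative
        (\<lambda>s. \<Sum>j\<in>UNIV. - (of_nat (m j) * (h w $ j * (of_real s * cnj (D j $ i)))))) (at 0)"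
      by (rule has_derivative_transform_eventually[OF L ev]) (simp_all add: ax0 h0)
    from has_derivative_unique[OF this R]
    have "(\<Sum>j\<in>UNIV. - (of_nat (m j) * (h w $ j * (of_real 1 * cnj (D j $ i))))) = - (of_nat (m i) * (w $ i * of_real 1))"
      by metis
    then show ?thesis
      by (simp add: sum_negf mult.assoc)
  qed
  define C :: "complex ^ 'n ^ 'n" where "C = (\<chi> i j. of_nat (m j) * cnj (D j $ i) / of_nat (m i))"
  have C: "C *v h w = w" if w: "w \<in> polydisk" for w
  proof -
    have "(C *v h w) $ i = w $ i" for i
    proof -
      have "(C *v h w) $ i = (\<Sum>j\<in>UNIV. of_nat (m j) * h w $ j * cnj (D j $ i)) / of_nat (m i)"
        by (simp add: C_def matrix_vector_mult_def sum_divide_distrib mult_ac)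
      then show ?thesis using m[of i] by (simp add: lin[OF w])
    qed
    then show ?thesis by (simp add: vec_eq_iff)
  qed
  \<comment> \<open>The range of \<open>C\<close> is a linear space that contains the polydisk,
    hence a neighborhood of 0.\<close>
  have "surj ((*v) C)"
    unfolding surj_def
  proof
    fix v :: "complex ^ 'n"
    obtain e :: real where e: "e > 0" and "ball 0 e \<subseteq> (polydisk :: (complex ^ 'n) set)"
      using open_polydisk zero_in_polydisk open_contains_ball by blast
    \<comment> \<open>Scales \<open>v\<close> into the ball of radius \<open>e\<close>; the summand
      1 takes care of \<open>v = 0\<close>.\<close>
    define s where "s = e / (2 * (norm v + 1))"
    have s: "s > 0" using e by (simp add: s_def add_nonneg_pos)
    have "norm (s *\<^sub>R v) < e"
    proof -
      have "norm (s *\<^sub>R v) = e * (norm v / (2 * (norm v + 1)))" using e by (simp add: s_def)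
      also have "\<dots> < e * 1" using e by (intro mult_strict_left_mono) (auto simp: divide_less_eq add_nonneg_pos)
      finally show ?thesis by simp
    qed
    with \<open>ball 0 e \<subseteq> polydisk\<close> have "s *\<^sub>R v \<in> polydisk" by auto
    from C[OF this] have "C *v h (s *\<^sub>R v) = s *\<^sub>R v" .
    then have "v = (1 / s) *\<^sub>R (C *v h (s *\<^sub>R v))" using s by simp
    also have "\<dots> = C *v ((1 / s) *\<^sub>R h (s *\<^sub>R v))"
      by (simp add: matrix_vector_mult_def vec_eq_iff scaleR_sum_right)
    finally show "\<exists>x. v = C *v x" ..
  qed
  then obtain B where "B ** C = mat 1"
    by (metis matrix_right_invertible_surjective matrix_left_right_inverse)
  then have "h w = B *v w" if "w \<in> polydisk" for w
    using C[OF that] by (metis matrix_vector_mul_assoc matrix_vector_mul_lid)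
  then show ?thesis by (rule that)
qed

text \<open>If the moduli in a row summed to more than 1, a point of the polydisk with suitable
  phases would make all terms of the row positive or zero and its image would have a coordinate
  equal to 1.\<close>

lemma row_sum_le_1:
  fixes B :: "complex ^ 'n::finite ^ 'n"
  assumes "\<And>w. w \<in> polydisk \<Longrightarrow> B *v w \<in> polydisk"
  shows "(\<Sum>k\<in>UNIV. cmod (B $ j $ k)) \<le> 1"
proof (rule ccontr)
  define S where "S = (\<Sum>k\<in>UNIV. cmod (B $ j $ k))"
  assume "\<not> (\<Sum>k\<in>UNIV. cmod (B $ j $ k)) \<le> 1"
  then have S: "S > 1" by (simp add: S_def)
  \<comment> \<open>The conjugate phases align the terms of row \<open>j\<close>, and the factor
    \<open>1 / S\<close> makes them add up to exactly 1. Zero entries have \<open>sgn\<close> equal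
    to 0 and contribute nothing.\<close>
  define w :: "complex ^ 'n" where "w = (\<chi> k. of_real (1 / S) * cnj (sgn (B $ j $ k)))"
  have "cmod (w $ k) < 1" for k
  proof -
    have "cmod (w $ k) \<le> 1 / S * 1"
      using S by (simp add: w_def norm_mult norm_divide norm_sgn)
    also have "\<dots> < 1" using S by simp
    finally show ?thesis .
  qed
  then have "cmod ((B *v w) $ j) < 1"
    using assms[of w] by (simp add: polydisk_iff)
  moreover have "(B *v w) $ j = 1"
  proof -
    have "B $ j $ k * w $ k = of_real (cmod (B $ j $ k) / S)" for k
    proof (cases "B $ j $ k = 0")
      case False
      then have "B $ j $ k * cnj (B $ j $ k) / of_real (cmod (B $ j $ k)) = of_real (cmod (B $ j $ k))"
        by (simp add: complex_norm_square[symmetric] power2_eq_square)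
      then show ?thesis
        by (simp add: w_def sgn_div_norm scaleR_conv_of_real divide_inverse mult_ac)
    qed (simp add: w_def)
    then have "(B *v w) $ j = of_real (\<Sum>k\<in>UNIV. cmod (B $ j $ k) / S)"
      by (simp add: matrix_vector_mult_def)
    also have "(\<Sum>k\<in>UNIV. cmod (B $ j $ k) / S) = 1"
      using S by (simp add: sum_divide_distrib[symmetric] S_def[symmetric])
    finally show ?thesis by simp
  qed
  ultimately show False by simp
qed

lemma monomial_matrix_of_kernel_identity:
  fixes B :: "complex ^ 'n::finite ^ 'n" and m :: "'n \<Rightarrow> nat"
  assumes m: "\<And>j. m j > 0"
    and B: "\<And>w. w \<in> polydisk \<Longrightarrow> B *v w \<in> polydisk"
    and eq: "\<And>w. w \<in> polydisk \<Longrightarrow>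
      (\<Prod>j\<in>UNIV. (1 - (B *v w) $ j * cnj ((B *v w) $ j)) ^ m j) = (\<Prod>j\<in>UNIV. (1 - w $ j * cnj (w $ j)) ^ m j)"
  obtains \<phi> where "bij \<phi>" "\<And>j. m (\<phi> j) = m j" "\<And>j. cmod (B $ j $ \<phi> j) = 1" "\<And>w j. (B *v w) $ j = B $ j $ \<phi> j * w $ \<phi> j"
proof -
  \<comment> \<open>The identity at the point \<open>s\<close> on the \<open>i\<close>-th axis: only
    column \<open>i\<close> of \<open>B\<close> is seen on the left, and only one factor differs
    from 1 on the right.\<close>
  have eq': "(\<Prod>j\<in>UNIV. (1 - s\<^sup>2 * (cmod (B $ j $ i))\<^sup>2) ^ m j) = (1 - s\<^sup>2) ^ m i" if s: "\<bar>s\<bar> < 1" for i and s :: real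
  proof -
    let ?w = "axis i (of_real s) :: complex ^ 'n"
    have w: "?w \<in> polydisk" using s by (intro axis_in_polydisk) simp
    have Bw: "(B *v ?w) $ j = B $ j $ i * of_real s" for j
      by (simp add: matrix_vector_mult_def axis_def if_distrib[where f = "\<lambda>x. _ * x"] cong: if_cong)
    have "(1 - (B *v ?w) $ j * cnj ((B *v ?w) $ j)) ^ m j = of_real ((1 - s\<^sup>2 * (cmod (B $ j $ i))\<^sup>2) ^ m j)" for j
    proof -
      have "(B *v ?w) $ j * cnj ((B *v ?w) $ j) = of_real ((cmod (B $ j $ i * of_real s))\<^sup>2)"
        unfolding Bw by (rule complex_norm_square[symmetric])
      also have "(cmod (B $ j $ i * of_real s))\<^sup>2 = s\<^sup>2 * (cmod (B $ j $ i))\<^sup>2"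
        by (simp add: norm_mult power_mult_distrib)
      finally show ?thesis by simp
    qed
    moreover have "(1 - ?w $ j * cnj (?w $ j)) ^ m j = (if j = i then of_real ((1 - s\<^sup>2) ^ m i) else 1)" for j
      by (auto simp: axis_def power2_eq_square)
    ultimately have "(\<Prod>j\<in>UNIV. of_real ((1 - s\<^sup>2 * (cmod (B $ j $ i))\<^sup>2) ^ m j)) = (complex_of_real ((1 - s\<^sup>2) ^ m i))"
      using eq[OF w] by simp
    then show ?thesis by (simp only: of_real_prod[symmetric] of_real_eq_iff)
  qed
  \<comment> \<open>As \<open>s\<close> tends to 1 the right side tends to 0, since
    \<open>m i > 0\<close>, so some factor of the left side vanishes at 1. A limit is taken because
    the point with \<open>s = 1\<close> lies on the boundary.\<close>
  have "\<exists>j. cmod (B $ j $ i) = 1" for i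
  proof -
    let ?L = "\<lambda>s::real. \<Prod>j\<in>UNIV. (1 - s\<^sup>2 * (cmod (B $ j $ i))\<^sup>2) ^ m j"
    have L: "(?L \<longlongrightarrow> ?L 1) (at_left 1)"
      by (intro tendsto_intros)
    have "((\<lambda>s::real. (1 - s\<^sup>2) ^ m i) \<longlongrightarrow> (1 - 1\<^sup>2) ^ m i) (at_left 1)"
      by (intro tendsto_intros)
    moreover have "\<forall>\<^sub>F s in at_left (1::real). (1 - s\<^sup>2) ^ m i = ?L s"
    proof (rule eventually_mono[OF eventually_at_left_real[of 0 1]])
      fix s :: real assume "s \<in> {0<..<1}"
      then have "\<bar>s\<bar> < 1" by simp
      then show "(1 - s\<^sup>2) ^ m i = ?L s" by (rule eq'[symmetric])
    qed simp
    ultimately have "(?L \<longlongrightarrow> (1 - 1\<^sup>2) ^ m i) (at_left 1)"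
      by (rule Lim_transform_eventually)
    with L have "?L 1 = (1 - 1\<^sup>2) ^ m i"
      by (rule tendsto_unique[OF trivial_limit_at_left_real])
    also have "\<dots> = 0" using m[of i] by simp
    finally obtain j where "(1 - 1\<^sup>2 * (cmod (B $ j $ i))\<^sup>2) ^ m j = 0" by auto
    then have "(cmod (B $ j $ i))\<^sup>2 = 1" by simp
    then have "cmod (B $ j $ i) = 1" by (simp add: abs_square_eq_1)
    then show ?thesis ..
  qed
  then obtain \<sigma> where \<sigma>: "\<And>i. cmod (B $ \<sigma> i $ i) = 1" by metis
  \<comment> \<open>An entry of modulus 1 already exhausts the bound on the sum of its row.\<close>
  have zero: "B $ \<sigma> i $ k = 0" if "k \<noteq> i" for i k
  proof -
    have "cmod (B $ \<sigma> i $ i) + cmod (B $ \<sigma> i $ k) = (\<Sum>k\<in>{i, k}. cmod (B $ \<sigma> i $ k))"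
      using that by auto
    also have "\<dots> \<le> (\<Sum>k\<in>UNIV. cmod (B $ \<sigma> i $ k))"
      by (intro sum_mono2) auto
    also have "\<dots> \<le> 1" using B by (rule row_sum_le_1)
    finally show ?thesis using \<sigma>[of i] by simp
  qed
  \<comment> \<open>A row chosen for two columns would have an entry that is 0 and of modulus
    1.\<close>
  have "inj \<sigma>"
  proof (rule injI)
    fix i k assume "\<sigma> i = \<sigma> k"
    then show "i = k" using zero[of k i] \<sigma>[of k] by (metis norm_zero zero_neq_one)
  qed
  then have \<sigma>_bij: "bij \<sigma>" by (simp add: bij_def finite_UNIV_inj_surj)
  define \<phi> where "\<phi> = inv \<sigma>"
  have \<sigma>\<phi>: "\<sigma> (\<phi> j) = j" for j
    using \<sigma>_bij by (simp add: \<phi>_def bij_is_surj surj_f_inv_f)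
  have B\<phi>: "cmod (B $ j $ \<phi> j) = 1" for j
    using \<sigma>[of "\<phi> j"] by (simp add: \<sigma>\<phi>)
  have B0: "B $ j $ k = 0" if "k \<noteq> \<phi> j" for j k
    using zero[OF that] by (simp add: \<sigma>\<phi>)
  show ?thesis
  proof
    show "bij \<phi>" unfolding \<phi>_def using \<sigma>_bij by (rule bij_imp_bij_inv)
    show "cmod (B $ j $ \<phi> j) = 1" for j by (rule B\<phi>)
    show "(B *v w) $ j = B $ j $ \<phi> j * w $ \<phi> j" for w j
    proof -
      have "(B *v w) $ j = (\<Sum>k\<in>UNIV. if k = \<phi> j then B $ j $ \<phi> j * w $ \<phi> j else 0)"
        unfolding matrix_vector_mult_def vec_lambda_beta by (intro sum.cong) (auto simp: B0)
      then show ?thesis by simp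
    qed
    \<comment> \<open>At \<open>s = 1/2\<close> a single factor is left on each side. Their common
      base 3/4 lies strictly between 0 and 1, so the exponents agree.\<close>
    show "m (\<phi> j) = m j" for j
    proof -
      have other: "B $ k $ \<phi> j = 0" if "k \<noteq> j" for k
        using B0[of "\<phi> j" k] that \<sigma>\<phi> by metis
      have "(\<Prod>k\<in>UNIV. (1 - (1/2)\<^sup>2 * (cmod (B $ k $ \<phi> j))\<^sup>2) ^ m k) = (\<Prod>k\<in>UNIV. if k = j then (3/4) ^ m j else (1::real))"
        by (intro prod.cong) (auto simp: other B\<phi> power2_eq_square)
      then have "(3/4 :: real) ^ m j = (3/4) ^ m (\<phi> j)"
        using eq'[of "1/2" "\<phi> j"] by (simp add: power2_eq_square)
      then show ?thesis
        by (simp add: power_inject_exp')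
    qed
  qed
qed

lemma disk_mobius_one_inverse:
  assumes "cmod t < 1" "cmod z < 1"
  shows "disk_mobius 1 t (disk_mobius 1 t z) = z"
  using disk_mobius_inverse[of 1 t z] assms by simp

lemma normal_form_of_kernel_identity:
  fixes l :: "nat ^ 'n::finite" and f :: "complex ^ 'n \<Rightarrow> complex" and g :: "complex ^ 'n \<Rightarrow> complex ^ 'n"
  assumes hol: "\<And>\<kappa>. mv_holomorphic_on (\<lambda>z. g z $ \<kappa>) polydisk" and g: "g ` polydisk \<subseteq> polydisk"
    and eq: "\<And>z w. z \<in> polydisk \<Longrightarrow> w \<in> polydisk \<Longrightarrow>
      (\<Prod>j\<in>UNIV. (1 - g w $ j * cnj (g z $ j)) ^ (l $ j + 2)) =
      f w * cnj (f z) * (\<Prod>j\<in>UNIV. (1 - w $ j * cnj (z $ j)) ^ (l $ j + 2))"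
  shows "\<exists>\<phi> c a \<theta>. mobius_data l \<phi> c a \<theta> \<and>
    (\<forall>z\<in>polydisk. f z = mobius_multiplier l \<phi> c a \<theta> z \<and> g z = polydisk_mobius \<phi> a \<theta> z)"
proof -
  define \<theta> where "\<theta> = g 0"
  have \<theta>: "\<theta> \<in> polydisk" using g zero_in_polydisk by (auto simp: \<theta>_def)
  have \<theta>1: "cmod (\<theta> $ j) < 1" for j using \<theta> by (rule polydiskD)
  have g1: "cmod (g w $ j) < 1" if "w \<in> polydisk" for w j
    using g that by (intro polydiskD) auto
  define h where "h w = polydisk_mobius id (\<chi> j. 1) \<theta> (g w)" for w
  have h_nth: "h w $ j = disk_mobius 1 (\<theta> $ j) (g w $ j)" for w j
    by (simp add: h_def polydisk_mobius_def)
  have h0: "h 0 = 0"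
    by (simp add: vec_eq_iff h_nth \<theta>_def disk_mobius_def)
  have h1: "cmod (h w $ j) < 1" if "w \<in> polydisk" for w j
    unfolding h_nth using \<theta>1 g1[OF that] by (intro norm_disk_mobius_less_1) auto
  have h_hol: "mv_holomorphic_on (\<lambda>z. h z $ \<kappa>) polydisk" for \<kappa>
    unfolding h_nth
  proof (rule mv_holomorphic_on_field_compose[OF hol])
    show "disk_mobius 1 (\<theta> $ \<kappa>) field_differentiable at (g z $ \<kappa>)" if "z \<in> polydisk" for z
      unfolding field_differentiable_def
      using disk_mobius_has_field_derivative[OF norm_one \<theta>1 g1[OF that]] by blast
  qed
  define q where "q j = 1 - (cmod (\<theta> $ j))\<^sup>2" for j
  have q: "q j > 0" for j using \<theta>1[of j] by (simp add: q_def abs_square_less_1)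
  define Q where "Q = (\<Prod>j\<in>UNIV. complex_of_real (q j) ^ (l $ j + 2))"
  have Q: "Q \<noteq> 0" using q by (simp add: Q_def less_imp_neq[symmetric])
  define d where "d w = (\<Prod>j\<in>UNIV. (1 - cnj (\<theta> $ j) * g w $ j) ^ (l $ j + 2))" for w
  \<comment> \<open>What remains of the multiplier once the denominators of the involution are
    absorbed. Setting \<open>z = 0\<close>, where \<open>h\<close> vanishes, forces it to be
    constant.\<close>
  define A where "A w = f w / d w" for w
  have A_eq: "(\<Prod>j\<in>UNIV. (1 - h w $ j * cnj (h z $ j)) ^ (l $ j + 2)) =
      Q * A w * cnj (A z) * (\<Prod>j\<in>UNIV. (1 - w $ j * cnj (z $ j)) ^ (l $ j + 2))"
    if z: "z \<in> polydisk" and w: "w \<in> polydisk" for z w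
  proof -
    have "1 - h w $ j * cnj (h z $ j) = of_real (q j) * (1 - g w $ j * cnj (g z $ j)) /
        ((1 - cnj (\<theta> $ j) * g w $ j) * cnj (1 - cnj (\<theta> $ j) * g z $ j))" for j
      unfolding h_nth q_def using one_minus_disk_mobius[of 1 "\<theta> $ j" "g w $ j" "g z $ j"] \<theta>1 g1[OF z] g1[OF w]
      by simp
    then have "(\<Prod>j\<in>UNIV. (1 - h w $ j * cnj (h z $ j)) ^ (l $ j + 2)) =
        Q * (\<Prod>j\<in>UNIV. (1 - g w $ j * cnj (g z $ j)) ^ (l $ j + 2)) / (d w * cnj (d z))"
      unfolding Q_def d_def cnj_prod complex_cnj_power prod.distrib[symmetric] prod_dividef[symmetric]
      by (simp only: power_divide power_mult_distrib)
    then show ?thesis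
      unfolding eq[OF z w] A_def by simp
  qed
  have A_const: "Q * A w * cnj (A 0) = 1" if "w \<in> polydisk" for w
    using A_eq[OF zero_in_polydisk that] by (simp add: h0)
  have A0: "A w = A 0" if "w \<in> polydisk" for w
  proof -
    have "Q * cnj (A 0) * A w = Q * cnj (A 0) * A 0" "Q * cnj (A 0) \<noteq> 0"
      using A_const[OF that] A_const[OF zero_in_polydisk] by (auto simp: mult_ac)
    then show ?thesis by (metis mult_left_cancel)
  qed
  have h_eq: "(\<Prod>j\<in>UNIV. (1 - h w $ j * cnj (h z $ j)) ^ (l $ j + 2)) = (\<Prod>j\<in>UNIV. (1 - w $ j * cnj (z $ j)) ^ (l $ j + 2))"
    if "z \<in> polydisk" "w \<in> polydisk" for z w
    using A_eq[OF that] A_const[OF that(2)] A0[OF that(1)] by simp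
  obtain B where B: "\<And>w. w \<in> polydisk \<Longrightarrow> h w = B *v w"
    using linear_of_kernel_identity[of h "\<lambda>j. l $ j + 2"] h_hol h0 h_eq by auto
  have B_polydisk: "B *v w \<in> polydisk" if "w \<in> polydisk" for w
    using h1[OF that] by (simp add: B[OF that, symmetric] polydisk_iff)
  have B_eq: "(\<Prod>j\<in>UNIV. (1 - (B *v w) $ j * cnj ((B *v w) $ j)) ^ (l $ j + 2)) = (\<Prod>j\<in>UNIV. (1 - w $ j * cnj (w $ j)) ^ (l $ j + 2))"
    if "w \<in> polydisk" for w
    using h_eq[OF that that] by (simp add: B[OF that])
  obtain \<phi> where \<phi>: "bij \<phi>" "\<And>j. l $ \<phi> j + 2 = l $ j + 2" "\<And>j. cmod (B $ j $ \<phi> j) = 1"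
      "\<And>w j. (B *v w) $ j = B $ j $ \<phi> j * w $ \<phi> j"
    by (rule monomial_matrix_of_kernel_identity[of "\<lambda>j. l $ j + 2" B, OF _ B_polydisk B_eq]) auto
  define a where "a = (\<chi> j. B $ j $ \<phi> j)"
  have a: "cmod (a $ j) = 1" for j using \<phi>(3) by (simp add: a_def)
  \<comment> \<open>The involution is its own inverse, so \<open>g\<close> is the involution applied
    to the monomial map \<open>h\<close>, whose coefficients become the rotation parameters.\<close>
  have g_eq: "g w = polydisk_mobius \<phi> a \<theta> w" if w: "w \<in> polydisk" for w
  proof -
    have "g w $ j = polydisk_mobius \<phi> a \<theta> w $ j" for j
    proof -
      have "g w $ j = disk_mobius 1 (\<theta> $ j) (h w $ j)"
        unfolding h_nth using \<theta>1 g1[OF w] by (intro disk_mobius_one_inverse[symmetric])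
      also have "\<dots> = disk_mobius 1 (\<theta> $ j) (a $ j * w $ \<phi> j)"
        by (simp add: B[OF w] \<phi>(4) a_def)
      finally show ?thesis
        by (simp add: polydisk_mobius_def disk_mobius_def mult_ac)
    qed
    then show ?thesis by (simp add: vec_eq_iff)
  qed
  define P where "P = (\<Prod>j\<in>UNIV. q j powr (1 + real (l $ j) / 2))"
  have P: "P > 0" unfolding P_def by (intro prod_pos ballI) (simp add: less_imp_neq[OF q, symmetric])
  have P2: "complex_of_real P * of_real P = Q"
  proof -
    have "P\<^sup>2 = (\<Prod>j\<in>UNIV. q j ^ (l $ j + 2))"
      unfolding P_def prod_power_distrib by (simp only: powr_half_square[OF q])
    then show ?thesis
      unfolding Q_def of_real_power[symmetric] of_real_prod[symmetric] of_real_mult[symmetric] power2_eq_square by simp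
  qed
  define E where "E w = (\<Prod>j\<in>UNIV. (1 - a $ j * cnj (\<theta> $ j) * w $ \<phi> j) ^ (l $ j + 2))" for w
  \<comment> \<open>The identity at \<open>z = 0\<close> determines \<open>f\<close> up to the
    constant \<open>cnj (f 0)\<close>, because the product on its right is 1 there.\<close>
  have f_eq: "f w * cnj (f 0) = Q / E w" if w: "w \<in> polydisk" for w
  proof -
    have "1 - g w $ j * cnj (g 0 $ j) = of_real (q j) / (1 - a $ j * cnj (\<theta> $ j) * w $ \<phi> j)" for j
      using mobius_denom_disk_mobius[OF a \<theta>1 polydiskD[OF w], of j j "\<phi> j"]
      by (simp add: g_eq[OF w] polydisk_mobius_def \<theta>_def[symmetric] q_def mult.commute)
    then show ?thesis
      using eq[OF zero_in_polydisk w] by (simp add: Q_def E_def power_divide prod_dividef del: power_Suc)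
  qed
  \<comment> \<open>At \<open>w = 0\<close> the formula \<open>f_eq\<close> gives
    \<open>(cmod (f 0))\<^sup>2 = P\<^sup>2\<close>, so dividing by \<open>P\<close> leaves a
    unimodular constant.\<close>
  define c where "c = f 0 / of_real P"
  have "complex_of_real ((cmod (f 0))\<^sup>2) = of_real (P\<^sup>2)"
    using f_eq[OF zero_in_polydisk] P2 unfolding complex_norm_square by (simp add: E_def power2_eq_square)
  then have "(cmod (f 0))\<^sup>2 = P\<^sup>2" by (simp only: of_real_eq_iff)
  then have norm_f0: "cmod (f 0) = P" using P by (simp add: power2_eq_iff_nonneg)
  then have c: "cmod c = 1" using P by (simp add: c_def norm_divide)
  have "f w = mobius_multiplier l \<phi> c a \<theta> w" if w: "w \<in> polydisk" for w
  proof -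
    have "mobius_multiplier l \<phi> c a \<theta> w = c * of_real P / E w"
      unfolding mobius_multiplier_def P_def E_def q_def of_real_prod prod_dividef by simp
    also have "\<dots> = f 0 / E w" using P by (simp add: c_def)
    also have "\<dots> = f w"
    proof -
      have f0: "f 0 \<noteq> 0" using norm_f0 P by auto
      have "f 0 * cnj (f 0) = Q"
        using f_eq[OF zero_in_polydisk] by (simp add: E_def)
      then have "f w * cnj (f 0) = f 0 / E w * cnj (f 0)"
        using f_eq[OF w] by simp
      then show ?thesis using f0 by (metis complex_cnj_zero_iff mult_right_cancel)
    qed
    finally show ?thesis ..
  qed
  moreover have "mobius_data l \<phi> c a \<theta>"
    using \<phi>(1,2) c a \<theta> by unfold_locales auto
  ultimately show ?thesis using g_eq by blast
qed

text \<open>With the denominators cleared, the identity can be differentiated and followed to the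
  boundary without keeping track of zeros.\<close>

lemma kernel_identity_imp_product_identity:
  assumes "z \<in> polydisk" "w \<in> polydisk" "g z \<in> polydisk" "g w \<in> polydisk"
    and eq: "f w * cnj (f z) * bergman_kernel l (g z) (g w) = bergman_kernel l z w"
  shows "(\<Prod>j\<in>UNIV. (1 - g w $ j * cnj (g z $ j)) ^ (l $ j + 2)) =
      f w * cnj (f z) * (\<Prod>j\<in>UNIV. (1 - w $ j * cnj (z $ j)) ^ (l $ j + 2))"
proof -
  have K: "bergman_kernel l z w = 1 / (\<Prod>j\<in>UNIV. (1 - w $ j * cnj (z $ j)) ^ (l $ j + 2))"
    and nz: "(\<Prod>j\<in>UNIV. (1 - w $ j * cnj (z $ j)) ^ (l $ j + 2)) \<noteq> 0"
    if "z \<in> polydisk" "w \<in> polydisk" for z w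
  proof -
    have "1 - w $ j * cnj (z $ j) \<noteq> 0" for j
      using mobius_denom_nonzero[of 1 "z $ j" "w $ j"] polydiskD[OF that(1)] polydiskD[OF that(2)]
      by (simp add: mult.commute)
    then show "(\<Prod>j\<in>UNIV. (1 - w $ j * cnj (z $ j)) ^ (l $ j + 2)) \<noteq> 0" by simp
    show "bergman_kernel l z w = 1 / (\<Prod>j\<in>UNIV. (1 - w $ j * cnj (z $ j)) ^ (l $ j + 2))"
      using that by (simp add: bergman_kernel_def prod_dividef mult.commute del: power_Suc)
  qed
  show ?thesis
    using eq nz[OF assms(1,2)] nz[OF assms(3,4)] unfolding K[OF assms(1,2)] K[OF assms(3,4)]
    by (simp add: field_simps del: power_Suc)
qed

lemma mobius_data_normal_form_iff:
  fixes l :: "nat ^ 'n::finite"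
  shows "mobius_data l \<phi> c a \<theta> \<and>
      (\<forall>z\<in>polydisk. f z = mobius_multiplier l \<phi> c a \<theta> z \<and> g z = polydisk_mobius \<phi> a \<theta> z) \<longleftrightarrow>
    bij \<phi> \<and> (\<forall>j. l $ \<phi> j = l $ j) \<and>
       c \<in> sphere 0 1 \<and> (\<forall>\<kappa>. a $ \<kappa> \<in> sphere 0 1) \<and> \<theta> \<in> polydisk \<and>
       (\<forall>z\<in>polydisk.
          f z = c * (\<Prod>j\<in>UNIV.
              complex_of_real ((1 - (cmod (\<theta> $ j))\<^sup>2) powr (1 + real (l $ j) / 2))
              / (1 - a $ j * cnj (\<theta> $ j) * z $ \<phi> j) ^ (l $ j + 2)) \<and>
          (\<forall>\<kappa>. g z $ \<kappa> = a $ \<kappa> * (cnj (a $ \<kappa>) * \<theta> $ \<kappa> - z $ \<phi> \<kappa>)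
              / (1 - a $ \<kappa> * cnj (\<theta> $ \<kappa>) * z $ \<phi> \<kappa>)))"
    (is "?D \<and> ?L \<longleftrightarrow> ?B \<and> ?l \<and> ?c \<and> ?a \<and> ?\<theta> \<and> ?R")
proof -
  have "?D \<longleftrightarrow> ?B \<and> ?l \<and> ?c \<and> ?a \<and> ?\<theta>"
    by (auto simp: mobius_data_def)
  moreover have "?L \<longleftrightarrow> ?R" if ?D
  proof -
    interpret mobius_data l \<phi> c a \<theta> by (rule that)
    have "a $ \<kappa> * (cnj (a $ \<kappa>) * \<theta> $ \<kappa> - u) = \<theta> $ \<kappa> - a $ \<kappa> * u" for \<kappa> u
      by (simp add: right_diff_distrib mult.assoc[symmetric] unimodular)
    then show ?thesis
      by (simp add: vec_eq_iff mobius_multiplier_def polydisk_mobius_def disk_mobius_def)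
  qed
  ultimately show ?thesis by blast
qed

lemma unitary_op_iff_normal_form:
  assumes "\<And>\<kappa>. mv_holomorphic_on (\<lambda>z. g z $ \<kappa>) polydisk" and g: "g ` polydisk \<subseteq> polydisk"
  shows "unitary_op l (weighted_comp_max l f g) \<longleftrightarrow> (\<exists>\<phi> c a \<theta>. mobius_data l \<phi> c a \<theta> \<and>
      (\<forall>z\<in>polydisk. f z = mobius_multiplier l \<phi> c a \<theta> z \<and> g z = polydisk_mobius \<phi> a \<theta> z))"
proof
  assume U: "unitary_op l (weighted_comp_max l f g)"
  show "\<exists>\<phi> c a \<theta>. mobius_data l \<phi> c a \<theta> \<and>
      (\<forall>z\<in>polydisk. f z = mobius_multiplier l \<phi> c a \<theta> z \<and> g z = polydisk_mobius \<phi> a \<theta> z)"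
  proof (rule normal_form_of_kernel_identity[OF assms])
    show "(\<Prod>j\<in>UNIV. (1 - g w $ j * cnj (g z $ j)) ^ (l $ j + 2)) =
      f w * cnj (f z) * (\<Prod>j\<in>UNIV. (1 - w $ j * cnj (z $ j)) ^ (l $ j + 2))"
      if "z \<in> polydisk" "w \<in> polydisk" for z w
      using that g unitary_imp_kernel_identity[OF U g that]
      by (intro kernel_identity_imp_product_identity) auto
  qed
next
  assume "\<exists>\<phi> c a \<theta>. mobius_data l \<phi> c a \<theta> \<and>
      (\<forall>z\<in>polydisk. f z = mobius_multiplier l \<phi> c a \<theta> z \<and> g z = polydisk_mobius \<phi> a \<theta> z)"
  then obtain \<phi> c a \<theta> where D: "mobius_data l \<phi> c a \<theta>"
    and fg: "\<And>z. z \<in> polydisk \<Longrightarrow> f z = mobius_multiplier l \<phi> c a \<theta> z"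
      "\<And>z. z \<in> polydisk \<Longrightarrow> g z = polydisk_mobius \<phi> a \<theta> z"
    by blast
  interpret D: mobius_data l \<phi> c a \<theta> by (rule D)
  have "weighted_comp f g = D.W"
    using fg by (rule weighted_comp_cong)
  \<comment> \<open>The maximal domain is the whole space because \<open>D.W\<close> maps the space
    into itself.\<close>
  then have "weighted_comp_max l f g = (bergman l, D.W)"
    using D.W_in_bergman by (auto simp: weighted_comp_max_def)
  then show "unitary_op l (weighted_comp_max l f g)"
    using D.unitary_op_W by simp
qed

theorem theorem4p2:
  fixes l :: "nat ^ 'n"
    and f :: "complex ^ 'n \<Rightarrow> complex"
    and g :: "complex ^ 'n \<Rightarrow> complex ^ 'n"
  assumes "mv_holomorphic_on f polydisk"
    and "\<And>\<kappa>. mv_holomorphic_on (\<lambda>z. g z $ \<kappa>) polydisk"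
    and "g ` polydisk \<subseteq> polydisk"
  shows "unitary_op l (weighted_comp_max l f g) \<longleftrightarrow>
    (\<exists>(\<phi> :: 'n \<Rightarrow> 'n) (c :: complex) (a :: complex ^ 'n) (\<theta> :: complex ^ 'n).
       bij \<phi> \<and> (\<forall>j. l $ \<phi> j = l $ j) \<and>
       c \<in> sphere 0 1 \<and> (\<forall>\<kappa>. a $ \<kappa> \<in> sphere 0 1) \<and> \<theta> \<in> polydisk \<and>
       (\<forall>z\<in>polydisk.
          f z = c * (\<Prod>j\<in>UNIV.
              complex_of_real ((1 - (cmod (\<theta> $ j))\<^sup>2) powr (1 + real (l $ j) / 2))
              / (1 - a $ j * cnj (\<theta> $ j) * z $ \<phi> j) ^ (l $ j + 2)) \<and>
          (\<forall>\<kappa>. g z $ \<kappa> = a $ \<kappa> * (cnj (a $ \<kappa>) * \<theta> $ \<kappa> - z $ \<phi> \<kappa>)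
              / (1 - a $ \<kappa> * cnj (\<theta> $ \<kappa>) * z $ \<phi> \<kappa>))))"
  unfolding unitary_op_iff_normal_form[OF assms(2,3)] mobius_data_normal_form_iff ..

end
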